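(* Let $X\cong S^1$ be the space of rays emanating from the origin of $\mathbb{R}^2$, with the natural action of $G=SL_2(\mathbb{R})$. Let $\Omega=X^{\mathbb{N}}$ with the product topology, let $\mathbf{G}=G^{\mathbb{N}}=SL_2(\mathbb{R})^{\mathbb{N}}$ be the product group, and let $\mathbf{G}$ act on $\Omega$ coordinatewise. Then the metric flow $(\Omega,\mathbf{G})$ is minimal and PI (of order $2$), and its enveloping semigroup $E(\Omega,\mathbf{G})$ has exactly $\mathfrak{c}=2^{\aleph_0}$ minimal left ideals.
   Context: A flow $(X,G)$ is a compact Hausdorff space $X$ together with a continuous homomorphism of the topological group $G$ into the group $\mathrm{Homeo}(X)$ of self-homeomorphisms of $X$ (compact-open topology), written $(g,x)\mapsto gx$. It is metric if $X$ is metrizable, and minimal if every orbit $Gx$ is dense in $X$. A homomorphism of flows is a continuous $G$-equivariant map (automatically surjective when the target is minimal); one also calls it an extension of its target. Enveloping semigroup: $E(X,G)$ is the closure in $X^X$ (product topology) of the set of maps $\{x\mapsto gx : g\in G\}$; it is a semigroup under composition. A left ideal is a nonempty subset $I\subset E(X,G)$ with $E(X,G)\,I\subset I$; it is minimal if it contains no strictly smaller left ideal. Two points $x_1,x_2$ of a flow are proximal if there is a net $g_i\in G$ with $\lim g_ix_1=\lim g_ix_2$. An extension $\phi:W'\to W$ is proximal if any two points with the same image under $\phi$ are proximal. It is equicontinuous if, with $R_\phi=\{(a,b)\in W'\times W':\phi(a)=\phi(b)\}$, for every neighborhood $\alpha$ of the diagonal in $W'\times W'$ there is a neighborhood $\beta$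 of the diagonal such that $(ga,gb)\in\alpha$ for all $g\in G$ and all $(a,b)\in\beta\cap R_\phi$ (for metrizable minimal flows such extensions are also called isometric). A minimal flow $(X,G)$ is strictly PI if there are an ordinal $\eta$ and a family of minimal flows $\{W_\iota\}_{\iota\le\eta}$ such that: $W_0$ is the trivial (one-point) flow; for every $\iota<\eta$ there is a homomorphism $\phi_\iota:W_{\iota+1}\to W_\iota$ which is either proximal or equicontinuous; for every limit ordinal $\nu\le\eta$, $W_\nu$ is the inverse limit of $\{W_\iota\}_{\iota<\nu}$; and $W_\eta=X$. A minimal flow $(X,G)$ is a PI-flow if there exist a strictly PI flow $\tilde X$ and a proximal homomorphism $\theta:\tilde X\to X$. "PI of order $n$" ($n\in\mathbb{N}$) means: strictly PI via such a tower of length $\eta=n$, i.e. obtained from the trivial flow by $n$ successive extensions, each non-trivial (not an isomorphism) and each either proximal or equicontinuous. *)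

theory Defs
  imports
    "HOL-Analysis.Analysis"
    "HOL-Algebra.Group_Action"
    "HOL-Algebra.Product_Groups"
    "HOL-Library.Equipollence"
begin

section \<open>Flows\<close>

definition topological_group :: "'g monoid \<Rightarrow> 'g topology \<Rightarrow> bool" where
  "topological_group G TG \<longleftrightarrow>
     group G \<and> topspace TG = carrier G \<and>
     continuous_map (prod_topology TG TG) TG (\<lambda>(g, h). g \<otimes>\<^bsub>G\<^esub> h) \<and>
     continuous_map TG TG (\<lambda>g. inv\<^bsub>G\<^esub> g)"

text \<open>Self-homeomorphisms are taken extensional, i.e. as elements of \<^const>\<open>Bij\<close>, the carrier
  of \<^const>\<open>BijGroup\<close>.\<close>

definition homeos :: "'x topology \<Rightarrow> ('x \<Rightarrow> 'x) set" where
  "homeos T = {h \<in> Bij (topspace T). homeomorphic_map T T h}"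

definition compact_open_topology :: "'x topology \<Rightarrow> ('x \<Rightarrow> 'x) topology" where
  "compact_open_topology T =
     topology_generated_by {{h \<in> homeos T. h ` K \<subseteq> U} | K U. compactin T K \<and> openin T U}"

record ('g, 'x) flow =
  phase :: "'x topology"
  act :: "'g \<Rightarrow> 'x \<Rightarrow> 'x"

abbreviation points :: "('g, 'x) flow \<Rightarrow> 'x set" where
  "points X \<equiv> topspace (phase X)"

definition is_flow :: "'g monoid \<Rightarrow> 'g topology \<Rightarrow> ('g, 'x) flow \<Rightarrow> bool" where
  "is_flow G TG X \<longleftrightarrow>
     topological_group G TG \<and>
     compact_space (phase X) \<and> Hausdorff_space (phase X) \<and> points X \<noteq> {} \<and>
     group_action G (points X) (act X) \<and>
     continuous_map TG (compact_open_topology (phase X)) (act X)"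

definition minimal_flow :: "'g monoid \<Rightarrow> 'g topology \<Rightarrow> ('g, 'x) flow \<Rightarrow> bool" where
  "minimal_flow G TG X \<longleftrightarrow>
     is_flow G TG X \<and>
     (\<forall>x\<in>points X. phase X closure_of orbit G (act X) x = points X)"

definition flow_hom ::
  "'g monoid \<Rightarrow> ('g, 'x) flow \<Rightarrow> ('g, 'y) flow \<Rightarrow> ('x \<Rightarrow> 'y) \<Rightarrow> bool" where
  "flow_hom G X Y f \<longleftrightarrow>
     continuous_map (phase X) (phase Y) f \<and>
     (\<forall>g\<in>carrier G. \<forall>x\<in>points X. f (act X g x) = act Y g (f x))"

definition flow_iso ::
  "'g monoid \<Rightarrow> ('g, 'x) flow \<Rightarrow> ('g, 'y) flow \<Rightarrow> ('x \<Rightarrow> 'y) \<Rightarrow> bool" where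
  "flow_iso G X Y f \<longleftrightarrow> flow_hom G X Y f \<and> homeomorphic_map (phase X) (phase Y) f"


section \<open>Enveloping semigroup and minimal left ideals\<close>

definition enveloping_semigroup :: "'g monoid \<Rightarrow> ('g, 'x) flow \<Rightarrow> ('x \<Rightarrow> 'x) set" where
  "enveloping_semigroup G X =
     product_topology (\<lambda>_. phase X) (points X) closure_of (act X ` carrier G)"

definition left_ideal :: "'g monoid \<Rightarrow> ('g, 'x) flow \<Rightarrow> ('x \<Rightarrow> 'x) set \<Rightarrow> bool" where
  "left_ideal G X I \<longleftrightarrow>
     I \<noteq> {} \<and> I \<subseteq> enveloping_semigroup G X \<and>
     (\<forall>p\<in>enveloping_semigroup G X. \<forall>q\<in>I. compose (points X) p q \<in> I)"

definition minimal_left_ideal :: "'g monoid \<Rightarrow> ('g, 'x) flow \<Rightarrow> ('x \<Rightarrow> 'x) set \<Rightarrow> bool" where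
  "minimal_left_ideal G X I \<longleftrightarrow>
     left_ideal G X I \<and> (\<forall>J. left_ideal G X J \<and> J \<subseteq> I \<longrightarrow> J = I)"


section \<open>Proximal and equicontinuous extensions\<close>

text \<open>A net in the group is represented by a proper filter containing the carrier.\<close>

definition proximal :: "'g monoid \<Rightarrow> ('g, 'x) flow \<Rightarrow> 'x \<Rightarrow> 'x \<Rightarrow> bool" where
  "proximal G X x y \<longleftrightarrow>
     (\<exists>F z. F \<noteq> bot \<and> eventually (\<lambda>g. g \<in> carrier G) F \<and>
        limitin (phase X) (\<lambda>g. act X g x) z F \<and>
        limitin (phase X) (\<lambda>g. act X g y) z F)"

definition proximal_hom ::
  "'g monoid \<Rightarrow> ('g, 'x) flow \<Rightarrow> ('g, 'y) flow \<Rightarrow> ('x \<Rightarrow> 'y) \<Rightarrow> bool" where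
  "proximal_hom G X Y f \<longleftrightarrow>
     flow_hom G X Y f \<and>
     (\<forall>x\<in>points X. \<forall>y\<in>points X. f x = f y \<longrightarrow> proximal G X x y)"

definition diagonal_nhd :: "'x topology \<Rightarrow> ('x \<times> 'x) set \<Rightarrow> bool" where
  "diagonal_nhd T \<alpha> \<longleftrightarrow>
     \<alpha> \<subseteq> topspace T \<times> topspace T \<and>
     (\<exists>U. openin (prod_topology T T) U \<and> Id_on (topspace T) \<subseteq> U \<and> U \<subseteq> \<alpha>)"

definition equicontinuous_hom ::
  "'g monoid \<Rightarrow> ('g, 'x) flow \<Rightarrow> ('g, 'y) flow \<Rightarrow> ('x \<Rightarrow> 'y) \<Rightarrow> bool" where
  "equicontinuous_hom G X Y f \<longleftrightarrow>
     flow_hom G X Y f \<and>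
     (\<forall>\<alpha>. diagonal_nhd (phase X) \<alpha> \<longrightarrow>
        (\<exists>\<beta>. diagonal_nhd (phase X) \<beta> \<and>
           (\<forall>g\<in>carrier G. \<forall>(a, b)\<in>\<beta>. f a = f b \<longrightarrow> (act X g a, act X g b) \<in> \<alpha>)))"


section \<open>PI-flows\<close>

text \<open>
  The ordinals \<open>\<iota> \<le> \<eta>\<close> are represented by a well-order \<^term>\<open>r\<close> with a greatest element
  (reflexive, as usual for \<^const>\<open>Well_order\<close>).
\<close>

definition successor_in :: "'i rel \<Rightarrow> 'i \<Rightarrow> 'i \<Rightarrow> bool" where
  "successor_in r i j \<longleftrightarrow> i \<in> Field r \<and> j \<in> Field r \<and> underS r j = under r i"

definition limit_in :: "'i rel \<Rightarrow> 'i \<Rightarrow> bool" where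
  "limit_in r j \<longleftrightarrow> j \<in> Field r \<and> underS r j \<noteq> {} \<and> (\<nexists>i. successor_in r i j)"

text \<open>\<^term>\<open>\<phi> i j\<close> is the bonding map from \<^term>\<open>W j\<close> to \<^term>\<open>W i\<close>.\<close>

definition inverse_limit_space ::
  "'i rel \<Rightarrow> 'i set \<Rightarrow> ('i \<Rightarrow> 'w topology) \<Rightarrow> ('i \<Rightarrow> 'i \<Rightarrow> 'w \<Rightarrow> 'w) \<Rightarrow> ('i \<Rightarrow> 'w) topology" where
  "inverse_limit_space r I T \<phi> =
     subtopology (product_topology T I)
       {x. \<forall>i\<in>I. \<forall>j\<in>I. (i, j) \<in> r \<longrightarrow> \<phi> i j (x j) = x i}"

definition PI_tower ::
  "'g monoid \<Rightarrow> 'g topology \<Rightarrow> 'i rel \<Rightarrow> ('i \<Rightarrow> ('g, 'w) flow) \<Rightarrow> ('i \<Rightarrow> 'i \<Rightarrow> 'w \<Rightarrow> 'w) \<Rightarrow>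
   ('g, 'w) flow \<Rightarrow> bool" where
  "PI_tower G TG r W \<phi> X \<longleftrightarrow>
     Well_order r \<and>
     (\<forall>i\<in>Field r. minimal_flow G TG (W i)) \<and>
     (\<forall>i j. (i, j) \<in> r \<longrightarrow> flow_hom G (W j) (W i) (\<phi> i j)) \<and>
     (\<forall>i\<in>Field r. \<forall>x\<in>points (W i). \<phi> i i x = x) \<and>
     (\<forall>i j k. (i, j) \<in> r \<and> (j, k) \<in> r \<longrightarrow>
        (\<forall>x\<in>points (W k). \<phi> i j (\<phi> j k x) = \<phi> i k x)) \<and>
     (\<forall>i\<in>Field r. underS r i = {} \<longrightarrow> (\<exists>p. points (W i) = {p})) \<and>
     (\<forall>i j. successor_in r i j \<longrightarrow>
        proximal_hom G (W j) (W i) (\<phi> i j) \<or> equicontinuous_hom G (W j) (W i) (\<phi> i j)) \<and>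
     (\<forall>j. limit_in r j \<longrightarrow>
        homeomorphic_map (phase (W j))
          (inverse_limit_space r (underS r j) (\<lambda>i. phase (W i)) \<phi>)
          (\<lambda>x. \<lambda>i\<in>underS r j. \<phi> i j x)) \<and>
     (\<exists>\<eta>\<in>Field r. (\<forall>i\<in>Field r. (i, \<eta>) \<in> r) \<and> W \<eta> = X)"

text \<open>
  Restricting the types of the levels and of the index set to the type of \<^term>\<open>X\<close> is no loss of
  generality: every level is a quotient of \<^term>\<open>X\<close>, hence isomorphic to a flow on a subset of
  the points of \<^term>\<open>X\<close>. Also, after deleting repeated levels, every successor step removes a
  pair from the associated closed equivalence relation on \<^term>\<open>X\<close>, so that \<open>\<eta> + 1\<close> embeds
  into a well-order on a subset of \<^term>\<open>X\<close> (for finite \<^term>\<open>X\<close> because a strictly decreasing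
  chain of equivalence relations on \<open>n\<close> points has at most \<open>n\<close> members).
\<close>

definition strictly_PI :: "'g monoid \<Rightarrow> 'g topology \<Rightarrow> ('g, 'x) flow \<Rightarrow> bool" where
  "strictly_PI G TG X \<longleftrightarrow>
     minimal_flow G TG X \<and>
     (\<exists>(r :: 'x rel) (W :: 'x \<Rightarrow> ('g, 'x) flow) \<phi>. PI_tower G TG r W \<phi> X)"

text \<open>
  A minimal flow of \<^term>\<open>G\<close> is a Hausdorff space with a dense subset of cardinality at most
  \<open>|G|\<close>, so it has at most \<open>2 ^ (2 ^ |G|)\<close> points. Hence the type \<^typ>\<open>'g set set\<close> is large
  enough to represent every candidate for the strictly PI extension.
\<close>

definition PI_flow :: "'g monoid \<Rightarrow> 'g topology \<Rightarrow> ('g, 'x) flow \<Rightarrow> bool" where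
  "PI_flow G TG X \<longleftrightarrow>
     minimal_flow G TG X \<and>
     (\<exists>(Y :: ('g, 'g set set) flow) \<theta>. strictly_PI G TG Y \<and> proximal_hom G Y X \<theta>)"

definition PI_of_order :: "'g monoid \<Rightarrow> 'g topology \<Rightarrow> nat \<Rightarrow> ('g, 'x) flow \<Rightarrow> bool" where
  "PI_of_order G TG n X \<longleftrightarrow>
     minimal_flow G TG X \<and>
     (\<exists>(W :: nat \<Rightarrow> ('g, 'x) flow) \<phi>. PI_tower G TG (natLeq_on (Suc n)) W \<phi> X \<and>
        (\<forall>i<n. \<not> flow_iso G (W (Suc i)) (W i) (\<phi> i (Suc i))))"


section \<open>The flow of rays and its countable power\<close>

definition ray :: "real^2 \<Rightarrow> (real^2) set" where
  "ray v = {t *\<^sub>R v | t. t \<ge> 0}"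

definition rays :: "(real^2) set set" where
  "rays = ray ` (UNIV - {0})"

text \<open>The quotient topology of the punctured plane; see \<open>quotient_map_ray\<close> and
  \<open>ray_topology_homeomorphic_circle\<close> below.\<close>

definition ray_topology :: "(real^2) set topology" where
  "ray_topology = topology (\<lambda>U. U \<subseteq> rays \<and> open {v. v \<noteq> 0 \<and> ray v \<in> U})"

definition SL2 :: "(real^2^2) monoid" where
  "SL2 = \<lparr>carrier = {A. det A = 1}, mult = (\<lambda>A B. A ** B), one = mat 1\<rparr>"

definition SL2_topology :: "(real^2^2) topology" where
  "SL2_topology = top_of_set (carrier SL2)"

definition ray_flow :: "(real^2^2, (real^2) set) flow" where
  "ray_flow = \<lparr>phase = ray_topology, act = (\<lambda>A. \<lambda>R\<in>rays. (\<lambda>v. A *v v) ` R)\<rparr>"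

definition power_flow :: "('g, 'x) flow \<Rightarrow> (nat \<Rightarrow> 'g, nat \<Rightarrow> 'x) flow" where
  "power_flow X =
     (let T = product_topology (\<lambda>_. phase X) UNIV
      in \<lparr>phase = T, act = (\<lambda>g. \<lambda>\<omega>\<in>topspace T. \<lambda>n. act X (g n) (\<omega> n))\<rparr>)"

definition Omega :: "(nat \<Rightarrow> real^2^2, nat \<Rightarrow> (real^2) set) flow" where
  "Omega = power_flow ray_flow"

definition SL2_power :: "(nat \<Rightarrow> real^2^2) monoid" where
  "SL2_power = product_group UNIV (\<lambda>_. SL2)"

definition SL2_power_topology :: "(nat \<Rightarrow> real^2^2) topology" where
  "SL2_power_topology = product_topology (\<lambda>_. SL2_topology) UNIV"

lemma openin_ray_topology:
  "openin ray_topology U \<longleftrightarrow> U \<subseteq> rays \<and> open {v. v \<noteq> 0 \<and> ray v \<in> U}"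
proof -
  have "istopology (\<lambda>U. U \<subseteq> rays \<and> open {v. v \<noteq> 0 \<and> ray v \<in> U})"
    unfolding istopology_def
  proof (intro conjI allI impI)
    fix S T assume S: "S \<subseteq> rays \<and> open {v. v \<noteq> 0 \<and> ray v \<in> S}"
      and T: "T \<subseteq> rays \<and> open {v. v \<noteq> 0 \<and> ray v \<in> T}"
    have "{v. v \<noteq> 0 \<and> ray v \<in> S \<inter> T} = {v. v \<noteq> 0 \<and> ray v \<in> S} \<inter> {v. v \<noteq> 0 \<and> ray v \<in> T}"
      by auto
    with S T show "open {v. v \<noteq> 0 \<and> ray v \<in> S \<inter> T}" by (simp add: open_Int)
    show "S \<inter> T \<subseteq> rays" using S by auto
  next
    fix K assume K: "\<forall>S\<in>K. S \<subseteq> rays \<and> open {v. v \<noteq> 0 \<and> ray v \<in> S}"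
    have "{v. v \<noteq> 0 \<and> ray v \<in> \<Union>K} = (\<Union>S\<in>K. {v. v \<noteq> 0 \<and> ray v \<in> S})" by auto
    then show "open {v. v \<noteq> 0 \<and> ray v \<in> \<Union>K}" using K by (simp only:) (rule open_UN, blast)
    show "\<Union>K \<subseteq> rays" using K by auto
  qed
  then show ?thesis by (simp add: ray_topology_def)
qed

lemma topspace_ray_topology [simp]: "topspace ray_topology = rays"
proof -
  have "{v. v \<noteq> 0 \<and> ray v \<in> rays} = - {0}" by (auto simp: rays_def)
  then have "openin ray_topology rays" by (simp add: openin_ray_topology open_Compl)
  then have "rays \<subseteq> topspace ray_topology" by (rule openin_subset)
  moreover have "topspace ray_topology \<subseteq> rays"
    using openin_topspace[of ray_topology] unfolding openin_ray_topology by (rule conjunct1)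
  ultimately show ?thesis by (rule subset_antisym[rotated])
qed

lemma quotient_map_ray: "quotient_map (top_of_set (UNIV - {0})) ray_topology ray"
  unfolding quotient_map_def
proof (intro conjI allI impI)
  show "ray ` topspace (top_of_set (UNIV - {0})) = topspace ray_topology"
    by (simp add: rays_def)
  fix U assume U: "U \<subseteq> topspace ray_topology"
  have "open (UNIV - {0 :: real^2})" by (simp add: open_delete)
  then show "openin (top_of_set (UNIV - {0})) {x \<in> topspace (top_of_set (UNIV - {0})). ray x \<in> U} \<longleftrightarrow>
      openin ray_topology U"
    using U by (auto simp: openin_open_eq openin_ray_topology)
qed

lemma ray_scaleR: "c > 0 \<Longrightarrow> ray (c *\<^sub>R v) = ray v"
proof -
  have *: "ray (c *\<^sub>R v) \<subseteq> ray v" if "c > 0" for c :: real and v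
    using that by (force simp: ray_def)
  assume c: "c > 0"
  show ?thesis
  proof
    show "ray (c *\<^sub>R v) \<subseteq> ray v" by (rule *[OF c])
    show "ray v \<subseteq> ray (c *\<^sub>R v)" using *[of "inverse c" "c *\<^sub>R v"] c by simp
  qed
qed

lemma ray_eq_iff_sgn:
  assumes "v \<noteq> 0" "w \<noteq> 0"
  shows "ray v = ray w \<longleftrightarrow> sgn v = sgn w"
proof
  assume "ray v = ray w"
  moreover have "v \<in> ray v" by (auto simp: ray_def intro: exI[of _ 1])
  ultimately obtain t where t: "v = t *\<^sub>R w" "t \<ge> 0" by (auto simp: ray_def)
  with assms have "t > 0" by (cases "t = 0") auto
  with t show "sgn v = sgn w" by (simp add: sgn_scaleR)
next
  assume "sgn v = sgn w"
  moreover have "ray (sgn u) = ray u" if "u \<noteq> 0" for u :: "real^2"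
    using that by (simp add: sgn_div_norm ray_scaleR)
  ultimately show "ray v = ray w" using assms by metis
qed

lemma ray_topology_homeomorphic_circle:
  "ray_topology homeomorphic_space top_of_set (sphere (0 :: real^2) 1)"
proof -
  let ?P = "top_of_set (UNIV - {0 :: real^2})" and ?S = "top_of_set (sphere (0 :: real^2) 1)"
  have sgn: "continuous_map ?P ?S sgn"
    by (auto simp: continuous_map_in_subtopology norm_sgn sgn_div_norm
        intro!: continuous_intros)
  obtain h where h: "continuous_map ray_topology ?S h" "\<And>v. v \<noteq> 0 \<Longrightarrow> h (ray v) = sgn v"
  proof (rule quotient_map_lift_exists[OF quotient_map_ray sgn])
    show "sgn v = sgn w"
      if "v \<in> topspace ?P" "w \<in> topspace ?P" "ray v = ray w" for v w
      using that ray_eq_iff_sgn by auto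
  qed auto
  have "continuous_map ?S ?P id"
    by (auto simp: continuous_map_in_subtopology)
  then have "continuous_map ?S ray_topology (ray \<circ> id)"
    using continuous_map_compose quotient_imp_continuous_map quotient_map_ray by blast
  moreover have "ray (h R) = R" if R: "R \<in> rays" for R
  proof -
    obtain v where v: "v \<noteq> 0" "R = ray v" using R by (auto simp: rays_def)
    then show ?thesis
      by (simp add: h sgn_div_norm ray_scaleR)
  qed
  moreover have "h (ray v) = v" if "v \<in> sphere 0 1" for v
  proof -
    have "norm v = 1" "v \<noteq> 0" using that by auto
    then show ?thesis by (simp add: h sgn_div_norm)
  qed
  ultimately have "homeomorphic_maps ray_topology ?S h ray"
    using h(1) by (simp add: homeomorphic_maps_def)
  then show ?thesis by (rule homeomorphic_maps_imp_homeomorphic_space)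
qed

end

theory Submission
  imports Defs
begin

text \<open>
  Every ray spans a line, so the product flow of rays lies over the product flow of lines, which lies
  over a point. The tower of length two consists of these three flows.

  The lower extension is proximal: the shears that fix a line attract every other line to it, and as
  the group is a full product this can be done in all coordinates at once, so that a single sequence
  of group elements contracts the whole space of sequences of lines to one point (\<open>proximal_step\<close>). The
  upper extension is equicontinuous because its fibres are the orbits of a compact group, that of the
  sign sequences, which acts freely and commutes with the action (\<open>equicontinuous_step\<close>). Minimality
  is immediate, the action being transitive.

  For the minimal left ideals, consider the limits of shears on rays rather than on lines. The limit
  of the shears fixing a sequence \<open>v\<close> of rays sends \<open>\<omega>\<close> to \<open>v\<close> with signs, where the \<open>n\<close>-th sign tells whether
  \<open>\<omega> n\<close> lies in the half-open half circle starting at \<open>v n\<close>. All elements of the enveloping semigroup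
  commute with signs, and it follows that the group orbit of such a limit is a minimal left ideal
  (\<open>minimal_left_ideal_shear\<close>). Different half circles give different ideals, whence at least continuum
  many of them (\<open>shear_ideal_slopes_distinct\<close>).

  In the other direction, minimal left ideals are pairwise disjoint, so it is enough that the
  enveloping semigroup has at most the cardinality of the continuum (\<open>E_lepoll_reals\<close>). In each
  coordinate a limit of elements of \<open>SL\<^sub>2\<close> is given by a nonzero matrix, a limit of the normalized
  elements, except on the kernel of that matrix, which contains at most two rays.
\<close>

section \<open>Flows, factors and finite towers\<close>

text \<open>
  For a compact phase space, joint continuity of the action is what makes the map into the
  homeomorphism group continuous for the compact-open topology; joint continuity is the form in which
  continuity is easy to verify for concrete actions and passes to factors and products.
\<close>

lemma is_flowI:
  assumes TG: "topological_group G TG"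
    and cpt: "compact_space (phase X)" and T2: "Hausdorff_space (phase X)"
    and ne: "points X \<noteq> {}"
    and ext: "\<And>g. g \<in> carrier G \<Longrightarrow> act X g \<in> extensional (points X)"
    and mult: "\<And>g h x. \<lbrakk>g \<in> carrier G; h \<in> carrier G; x \<in> points X\<rbrakk> \<Longrightarrow>
                 act X (g \<otimes>\<^bsub>G\<^esub> h) x = act X g (act X h x)"
    and one: "\<And>x. x \<in> points X \<Longrightarrow> act X \<one>\<^bsub>G\<^esub> x = x"
    and cont: "continuous_map (prod_topology TG (phase X)) (phase X) (\<lambda>(g, x). act X g x)"
  shows "is_flow G TG X"
proof -
  have grp: "group G" and top: "topspace TG = carrier G"
    using TG by (auto simp: topological_group_def)
  have cl: "act X g x \<in> points X" if "g \<in> carrier G" "x \<in> points X" for g x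
    using continuous_map_image_subset_topspace[OF cont] that top by (auto simp: image_subset_iff)
  have actc: "continuous_map (phase X) (phase X) (act X g)" if g: "g \<in> carrier G" for g
  proof -
    have "continuous_map (phase X) (prod_topology TG (phase X)) (\<lambda>x. (g, x))"
      using g top by (auto simp: continuous_map_pairwise o_def)
    from continuous_map_compose[OF this cont] show ?thesis by (simp add: o_def)
  qed
  have inv1: "act X (inv\<^bsub>G\<^esub> g) (act X g x) = x" if "g \<in> carrier G" "x \<in> points X" for g x
    using mult[of "inv\<^bsub>G\<^esub> g" g x] one that by (simp add: group.l_inv[OF grp] group.inv_closed[OF grp])
  have inv2: "act X g (act X (inv\<^bsub>G\<^esub> g) x) = x" if "g \<in> carrier G" "x \<in> points X" for g x
    using mult[of g "inv\<^bsub>G\<^esub> g" x] one that by (simp add: group.r_inv[OF grp] group.inv_closed[OF grp])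
  have hm: "homeomorphic_maps (phase X) (phase X) (act X g) (act X (inv\<^bsub>G\<^esub> g))" if "g \<in> carrier G" for g
    using that by (auto simp: homeomorphic_maps_def actc inv1 inv2 group.inv_closed[OF grp])
  have bij: "act X g \<in> Bij (points X)" if g: "g \<in> carrier G" for g
    unfolding Bij_def using ext[OF g] hm[OF g]
    by (metis IntI homeomorphic_imp_injective_map homeomorphic_imp_surjective_map
        homeomorphic_maps_map mem_Collect_eq bij_betw_def)
  have hom: "act X g \<in> homeos (phase X)" if g: "g \<in> carrier G" for g
    using bij[OF g] hm[OF g] homeomorphic_maps_map unfolding homeos_def by blast
  have "group_action G (points X) (act X)"
  proof (intro group_action.intro group_hom.intro group_hom_axioms.intro homI)
    show "act X g \<in> carrier (BijGroup (points X))" if "g \<in> carrier G" for g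
      using bij[OF that] by (simp add: BijGroup_def)
    fix g h assume gh: "g \<in> carrier G" "h \<in> carrier G"
    have gm: "g \<otimes>\<^bsub>G\<^esub> h \<in> carrier G" using gh grp by (simp add: group.is_monoid monoid.m_closed)
    show "act X (g \<otimes>\<^bsub>G\<^esub> h) = act X g \<otimes>\<^bsub>BijGroup (points X)\<^esub> act X h"
      using gh bij mult ext[OF gm]
      by (auto simp: BijGroup_def compose_def extensional_def fun_eq_iff)
  qed (auto simp: grp group_BijGroup)
  moreover have "continuous_map TG (compact_open_topology (phase X)) (act X)"
    unfolding compact_open_topology_def
  proof (rule continuous_on_generated_topo)
    fix V assume "V \<in> {{h \<in> homeos (phase X). h ` K \<subseteq> U} | K U. compactin (phase X) K \<and> openin (phase X) U}"
    then obtain K U where K: "compactin (phase X) K" and U: "openin (phase X) U"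
      and V: "V = {h \<in> homeos (phase X). h ` K \<subseteq> U}" by auto
    \<comment> \<open>The complement is the projection of a closed subset of \<open>K \<times> G\<close> along the compact factor.\<close>
    let ?K = "subtopology (phase X) K"
    have KX: "K \<subseteq> points X" using K compactin_subset_topspace by blast
    have c2: "continuous_map (prod_topology ?K TG) (phase X) (\<lambda>(x, g). act X g x)"
    proof -
      have "continuous_map (prod_topology ?K TG) (prod_topology TG (phase X)) (\<lambda>p. (snd p, fst p))"
        by (auto simp: continuous_map_pairwise o_def continuous_map_snd
            intro: continuous_map_into_fulltopology continuous_map_fst)
      from continuous_map_compose[OF this cont] show ?thesis
        by (simp add: o_def case_prod_unfold)
    qed
    let ?C = "{p \<in> topspace (prod_topology ?K TG). (\<lambda>(x, g). act X g x) p \<in> points X - U}"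
    have "closedin (prod_topology ?K TG) ?C"
      using c2 U by (intro closedin_continuous_map_preimage) auto
    moreover have "closed_map (prod_topology ?K TG) TG snd"
      by (rule closed_map_snd) (use K compact_space_subtopology in blast)
    ultimately have "closedin TG (snd ` ?C)" by (auto simp: closed_map_def)
    moreover have "act X -` V \<inter> topspace TG = topspace TG - snd ` ?C"
    proof (intro Set.set_eqI iffI)
      fix g assume g: "g \<in> act X -` V \<inter> topspace TG"
      then show "g \<in> topspace TG - snd ` ?C" by (auto simp: V)
    next
      fix g assume g: "g \<in> topspace TG - snd ` ?C"
      have "act X g x \<in> U" if "x \<in> K" for x
      proof (rule ccontr)
        assume "act X g x \<notin> U"
        then have "(x, g) \<in> ?C" using g that KX cl top by auto
        then show False using g by force
      qed
      then show "g \<in> act X -` V \<inter> topspace TG" using g hom top by (auto simp: V)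
    qed
    ultimately show "openin TG (act X -` V \<inter> topspace TG)" by auto
  next
    have "homeos (phase X) \<in> {{h \<in> homeos (phase X). h ` K \<subseteq> U} | K U. compactin (phase X) K \<and> openin (phase X) U}"
      by (rule CollectI, rule exI[of _ "{}"], rule exI[of _ "{}"]) auto
    then show "act X ` topspace TG \<subseteq>
      \<Union> {{h \<in> homeos (phase X). h ` K \<subseteq> U} | K U. compactin (phase X) K \<and> openin (phase X) U}"
      using hom top by blast
  qed
  ultimately show ?thesis using assms by (simp add: is_flow_def)
qed

lemma flow_act:
  assumes "is_flow G TG X"
  shows "g \<in> carrier G \<Longrightarrow> x \<in> points X \<Longrightarrow> act X g x \<in> points X"
    and "x \<in> points X \<Longrightarrow> act X \<one>\<^bsub>G\<^esub> x = x"
    and "\<lbrakk>g \<in> carrier G; h \<in> carrier G; x \<in> points X\<rbrakk> \<Longrightarrow>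
           act X (g \<otimes>\<^bsub>G\<^esub> h) x = act X g (act X h x)"
    and "g \<in> carrier G \<Longrightarrow> act X g \<in> extensional (points X)"
proof -
  interpret group_action G "points X" "act X" using assms by (simp add: is_flow_def)
  show "g \<in> carrier G \<Longrightarrow> x \<in> points X \<Longrightarrow> act X g x \<in> points X"
    using element_image by blast
  show "x \<in> points X \<Longrightarrow> act X \<one>\<^bsub>G\<^esub> x = x"
    using id_eq_one by (metis restrict_apply')
  show "\<lbrakk>g \<in> carrier G; h \<in> carrier G; x \<in> points X\<rbrakk> \<Longrightarrow>
           act X (g \<otimes>\<^bsub>G\<^esub> h) x = act X g (act X h x)"
    using composition_rule by blast
  show "g \<in> carrier G \<Longrightarrow> act X g \<in> extensional (points X)"
    using bij_prop0 Bij_imp_extensional by blast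
qed

text \<open>
  The equivalence relation is given twice: by \<open>k\<close>, which supplies the topology, and by \<open>q\<close>, which
  supplies the points. Pulling the topology back along an injective map into a Hausdorff space makes
  the factor Hausdorff without any argument about quotient topologies, while \<open>q\<close> is free to name
  the classes by elements of any type; so isomorphic copies of a flow in another type arise in the
  same way as proper factors.
\<close>

definition factor_flow ::
  "('g, 'x) flow \<Rightarrow> 'z topology \<Rightarrow> ('x \<Rightarrow> 'z) \<Rightarrow> ('x \<Rightarrow> 'w) \<Rightarrow> ('g, 'w) flow" where
  "factor_flow X Z k q =
     \<lparr>phase = pullback_topology (q ` points X) (\<lambda>w. k (inv_into (points X) q w)) Z,
      act = (\<lambda>g. \<lambda>w\<in>q ` points X. q (act X g (inv_into (points X) q w)))\<rparr>"

text \<open>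
  The map \<open>q\<close> is continuous from a compact to a Hausdorff space, hence proper. Its product with the
  identity of the group is therefore still a quotient map, and this is what lets the joint
  continuity of the action descend.
\<close>

lemma factor_flow:
  assumes X: "minimal_flow G TG X"
    and cont: "continuous_map (prod_topology TG (phase X)) (phase X) (\<lambda>(g, x). act X g x)"
    and Z: "Hausdorff_space Z" and k: "continuous_map (phase X) Z k"
    and ker: "\<And>x y. \<lbrakk>x \<in> points X; y \<in> points X\<rbrakk> \<Longrightarrow> k x = k y \<longleftrightarrow> q x = q y"
    and inv: "\<And>g x y. \<lbrakk>g \<in> carrier G; x \<in> points X; y \<in> points X; q x = q y\<rbrakk> \<Longrightarrow>
                q (act X g x) = q (act X g y)"
  shows "points (factor_flow X Z k q) = q ` points X"
    and "flow_hom G X (factor_flow X Z k q) q"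
    and "minimal_flow G TG (factor_flow X Z k q)"
proof -
  let ?Y = "factor_flow X Z k q" and ?p = "inv_into (points X) q"
  have fl: "is_flow G TG X" using X by (simp add: minimal_flow_def)
  have TG: "topological_group G TG" and cpt: "compact_space (phase X)" and ne: "points X \<noteq> {}"
    using fl by (auto simp: is_flow_def)
  have grp: "group G" and top: "topspace TG = carrier G"
    using TG by (auto simp: topological_group_def)
  note fa = flow_act[OF fl]
  have p: "?p w \<in> points X" "q (?p w) = w" if "w \<in> q ` points X" for w
    using that by (auto intro: inv_into_into f_inv_into_f)
  have kp: "k (?p (q x)) = k x" if "x \<in> points X" for x
    using ker p that by auto
  have kZ: "k x \<in> topspace Z" if "x \<in> points X" for x
    using k that by (auto simp: continuous_map_def)
  show pts: "points ?Y = q ` points X"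
    using p kZ by (auto simp: factor_flow_def topspace_pullback_topology)
  have qact: "act ?Y g (q x) = q (act X g x)" if "g \<in> carrier G" "x \<in> points X" for g x
    using that p by (auto simp: factor_flow_def intro!: inv)
  have qc: "continuous_map (phase X) (phase ?Y) q"
    unfolding factor_flow_def flow.simps
  proof (rule continuous_map_pullback')
    show "continuous_map (phase X) Z ((\<lambda>w. k (?p w)) \<circ> q)"
      by (rule continuous_map_eq[OF k]) (simp add: kp)
  qed auto
  then show hom: "flow_hom G X ?Y q" by (auto simp: flow_hom_def qact)
  have "continuous_map (phase ?Y) Z (id \<circ> (\<lambda>w. k (?p w)))"
    unfolding factor_flow_def flow.simps by (rule continuous_map_pullback) simp
  moreover have "inj_on (\<lambda>w. k (?p w)) (points ?Y)"
    unfolding pts by (auto simp: inj_on_def kp ker)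
  ultimately have T2: "Hausdorff_space (phase ?Y)"
    using Hausdorff_space_injective_preimage[OF Z] by (simp add: o_def)
  have cptY: "compact_space (phase ?Y)"
    using cpt image_compactin[OF _ qc] pts by (metis compact_space_def)
  have "proper_map (phase X) (phase ?Y) q"
    using cpt T2 qc by (simp add: continuous_imp_proper_map Hausdorff_imp_kc_space)
  then have "proper_map (prod_topology TG (phase X)) (prod_topology TG (phase ?Y)) (\<lambda>(g, x). (id g, q x))"
    unfolding proper_map_prod using proper_map_id by blast
  then have cm: "closed_map (prod_topology TG (phase X)) (prod_topology TG (phase ?Y)) (\<lambda>(g, x). (g, q x))"
    by (auto dest: proper_imp_closed_map)
  have qm: "quotient_map (prod_topology TG (phase X)) (prod_topology TG (phase ?Y)) (\<lambda>(g, x). (g, q x))"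
  proof (rule continuous_closed_imp_quotient_map[OF _ cm])
    show "continuous_map (prod_topology TG (phase X)) (prod_topology TG (phase ?Y)) (\<lambda>(g, x). (g, q x))"
      using continuous_map_compose[OF continuous_map_snd qc]
      by (auto simp: continuous_map_pairwise o_def case_prod_beta continuous_map_fst)
    show "(\<lambda>(g, x). (g, q x)) ` topspace (prod_topology TG (phase X)) = topspace (prod_topology TG (phase ?Y))"
      by (force simp: pts)
  qed
  have contY: "continuous_map (prod_topology TG (phase ?Y)) (phase ?Y) (\<lambda>(g, x). act ?Y g x)"
  proof (rule continuous_compose_quotient_map[OF qm])
    show "continuous_map (prod_topology TG (phase X)) (phase ?Y) ((\<lambda>(g, x). act ?Y g x) \<circ> (\<lambda>(g, x). (g, q x)))"
      by (rule continuous_map_eq[OF continuous_map_compose[OF cont qc]]) (auto simp: top qact)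
  qed
  have flY: "is_flow G TG ?Y"
  proof (rule is_flowI[OF TG cptY T2 _ _ _ _ contY])
    show "points ?Y \<noteq> {}" using ne pts by simp
    show "act ?Y g \<in> extensional (points ?Y)" for g
      unfolding pts by (simp add: factor_flow_def)
    fix x assume "x \<in> points ?Y"
    then obtain x' where x': "x' \<in> points X" "x = q x'" unfolding pts by blast
    have "\<one>\<^bsub>G\<^esub> \<in> carrier G" using grp by (simp add: group.is_monoid)
    then show "act ?Y \<one>\<^bsub>G\<^esub> x = x" using x' by (simp add: qact fa)
    fix g h assume gh: "g \<in> carrier G" "h \<in> carrier G"
    then have "g \<otimes>\<^bsub>G\<^esub> h \<in> carrier G" using grp by (simp add: group.is_monoid monoid.m_closed)
    then show "act ?Y (g \<otimes>\<^bsub>G\<^esub> h) x = act ?Y g (act ?Y h x)"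
      using gh x' by (simp add: qact fa)
  qed
  show "minimal_flow G TG ?Y"
    unfolding minimal_flow_def
  proof (intro conjI ballI flY)
    fix y assume "y \<in> points ?Y"
    then obtain x where x: "x \<in> points X" "y = q x" unfolding pts by blast
    have "q ` orbit G (act X) x = orbit G (act ?Y) y"
      using x by (auto simp: orbit_def qact image_iff) (metis qact)
    moreover have "q ` (phase X closure_of orbit G (act X) x) \<subseteq> phase ?Y closure_of (q ` orbit G (act X) x)"
      by (rule continuous_map_image_closure_subset[OF qc])
    ultimately have "q ` points X \<subseteq> phase ?Y closure_of orbit G (act ?Y) y"
      using X x by (simp add: minimal_flow_def)
    then show "phase ?Y closure_of orbit G (act ?Y) y = points ?Y"
      using pts closure_of_subset_topspace by (metis subset_antisym)
  qed
qed

text \<open>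
  The choice of representatives made by \<^const>\<open>inv_into\<close> is immaterial, and continuity of the induced
  map holds because \<open>q\<close> is a quotient map.
\<close>

lemma induced_hom:
  assumes ker: "\<And>x y. \<lbrakk>x \<in> points X; y \<in> points X; q x = q y\<rbrakk> \<Longrightarrow> p x = p y"
  shows "x \<in> points X \<Longrightarrow> p (inv_into (points X) q (q x)) = p x"
    and "\<lbrakk>is_flow G TG X; Hausdorff_space (phase Y); flow_hom G X Y q; points Y = q ` points X;
          flow_hom G X Z p\<rbrakk> \<Longrightarrow> flow_hom G Y Z (\<lambda>w. p (inv_into (points X) q w))"
proof -
  have pq: "p (inv_into (points X) q (q x)) = p x" if "x \<in> points X" for x
    using that by (intro ker) (auto intro: inv_into_into f_inv_into_f)
  then show "x \<in> points X \<Longrightarrow> p (inv_into (points X) q (q x)) = p x" .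
  assume X: "is_flow G TG X" and T2: "Hausdorff_space (phase Y)" and q: "flow_hom G X Y q"
    and Y: "points Y = q ` points X" and p: "flow_hom G X Z p"
  let ?f = "\<lambda>w. p (inv_into (points X) q w)"
  have cq: "continuous_map (phase X) (phase Y) q" and cp: "continuous_map (phase X) (phase Z) p"
    using q p by (simp_all add: flow_hom_def)
  have "closed_map (phase X) (phase Y) q"
    using X T2 cq by (intro continuous_imp_closed_map) (auto simp: is_flow_def)
  then have "quotient_map (phase X) (phase Y) q"
    using Y cq by (intro continuous_closed_imp_quotient_map) auto
  moreover have "continuous_map (phase X) (phase Z) (?f \<circ> q)"
    by (rule continuous_map_eq[OF cp]) (simp add: pq)
  ultimately have "continuous_map (phase Y) (phase Z) ?f"
    by (rule continuous_compose_quotient_map)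
  moreover have "?f (act Y g y) = act Z g (?f y)" if gy: "g \<in> carrier G" "y \<in> points Y" for g y
  proof -
    obtain x where x: "x \<in> points X" "y = q x" using gy Y by auto
    have "act Y g y = q (act X g x)" "act Z g (p x) = p (act X g x)"
      using x gy q p by (auto simp: flow_hom_def)
    then show ?thesis using x gy flow_act(1)[OF X] by (simp add: pq)
  qed
  ultimately show "flow_hom G Y Z ?f" by (simp add: flow_hom_def)
qed

text \<open>
  When all levels are factors of one flow, the bonding maps are the induced ones, so that they are
  automatically homomorphisms and compatible with each other. A finite tower has no limit stages. The
  ordinals up to \<open>n\<close> may be renamed by \<open>\<iota>\<close>, because strict PI asks for an index set inside the type of
  the points.
\<close>

lemma PI_tower_of_factors:
  fixes X :: "('g, 'x) flow" and W :: "nat \<Rightarrow> ('g, 'w) flow" and q :: "nat \<Rightarrow> 'x \<Rightarrow> 'w" and \<iota> :: "nat \<Rightarrow> 'i"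
  defines "\<phi> \<equiv> \<lambda>i j w. q i (inv_into (points X) (q j) w)"
  assumes \<iota>: "inj_on \<iota> {..n}"
    and X: "minimal_flow G TG X"
    and W: "\<And>i. i \<le> n \<Longrightarrow> minimal_flow G TG (W i)"
    and q: "\<And>i. i \<le> n \<Longrightarrow> flow_hom G X (W i) (q i)"
    and surj: "\<And>i. i \<le> n \<Longrightarrow> points (W i) = q i ` points X"
    and ker: "\<And>i j x y. \<lbrakk>i \<le> j; j \<le> n; x \<in> points X; y \<in> points X; q j x = q j y\<rbrakk> \<Longrightarrow> q i x = q i y"
    and triv: "\<exists>p. points (W 0) = {p}"
    and step: "\<And>i. i < n \<Longrightarrow>
        proximal_hom G (W (Suc i)) (W i) (\<phi> i (Suc i)) \<or>
        equicontinuous_hom G (W (Suc i)) (W i) (\<phi> i (Suc i))"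
  shows "PI_tower G TG (dir_image (natLeq_on (Suc n)) \<iota>) (\<lambda>a. W (inv_into {..n} \<iota> a))
           (\<lambda>a b. \<phi> (inv_into {..n} \<iota> a) (inv_into {..n} \<iota> b)) (W n)"
proof -
  let ?r = "dir_image (natLeq_on (Suc n)) \<iota>" and ?v = "inv_into {..n} \<iota>"
  have v: "?v (\<iota> i) = i" if "i \<le> n" for i using \<iota> that by simp
  have Fn: "Field (natLeq_on (Suc n)) = {..n}" by (auto simp: Field_natLeq_on)
  have F: "Field ?r = \<iota> ` {..n}" by (simp only: dir_image_Field Fn)
  have r: "(a, b) \<in> ?r \<longleftrightarrow> (\<exists>i j. i \<le> j \<and> j \<le> n \<and> a = \<iota> i \<and> b = \<iota> j)" for a b
    by (fastforce simp: dir_image_def)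
  have inj: "\<iota> i = \<iota> j \<longleftrightarrow> i = j" if "i \<le> n" "j \<le> n" for i j
    using \<iota> that by (auto simp: inj_on_def)
  have uS: "underS ?r (\<iota> j) = \<iota> ` {..<j}" if "j \<le> n" for j
    using that by (auto simp: underS_def r inj) (metis less_imp_le)
  have un: "under ?r (\<iota> j) = \<iota> ` {..j}" if "j \<le> n" for j
    using that by (auto simp: under_def r inj)
  have succ: "successor_in ?r a b \<longleftrightarrow> (\<exists>i<n. a = \<iota> i \<and> b = \<iota> (Suc i))" for a b
  proof
    assume s: "successor_in ?r a b"
    then obtain i j where ij: "i \<le> n" "j \<le> n" "a = \<iota> i" "b = \<iota> j"
      by (auto simp: successor_in_def F)
    with s have "\<iota> ` {..<j} = \<iota> ` {..i}" by (simp add: successor_in_def uS un)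
    then have "{..<j} = {..i}" using inj_on_image_eq_iff[OF \<iota>] ij by (simp add: subset_iff)
    then have "j = Suc i" by (metis lessThan_Suc_atMost lessThan_eq_iff)
    then show "\<exists>i<n. a = \<iota> i \<and> b = \<iota> (Suc i)" using ij Suc_le_lessD by blast
  next
    assume "\<exists>i<n. a = \<iota> i \<and> b = \<iota> (Suc i)"
    then show "successor_in ?r a b"
      by (auto simp: successor_in_def F uS un lessThan_Suc_atMost)
  qed
  have nolim: "\<not> limit_in ?r a" for a
  proof
    assume l: "limit_in ?r a"
    then obtain j where j: "j \<le> n" "a = \<iota> j" by (auto simp: limit_in_def F)
    show False
    proof (cases j)
      case 0
      with l j show False by (simp add: limit_in_def uS)
    next
      case (Suc i)
      then have "successor_in ?r (\<iota> i) a" unfolding succ using j by (intro exI[of _ i]) auto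
      with l show False by (auto simp: limit_in_def)
    qed
  qed
  have wo: "Well_order ?r"
    by (rule Well_order_dir_image[OF natLeq_on_Well_order]) (simp only: Fn \<iota>)
  have fl: "is_flow G TG X" using X by (simp add: minimal_flow_def)
  have T2: "Hausdorff_space (phase (W j))" if "j \<le> n" for j
    using W[OF that] by (simp add: minimal_flow_def is_flow_def)
  have \<phi>q: "\<phi> i j (q j x) = q i x" if "i \<le> j" "j \<le> n" "x \<in> points X" for i j x
    unfolding \<phi>_def using that ker[of i j] by (intro induced_hom(1)[where p = "q i"])
  have hom: "flow_hom G (W j) (W i) (\<phi> i j)" if "i \<le> j" "j \<le> n" for i j
    unfolding \<phi>_def
  proof (rule induced_hom(2)[OF _ fl T2[OF that(2)] q[OF that(2)] surj[OF that(2)]])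
    show "flow_hom G X (W i) (q i)" using that by (intro q) simp
  qed (rule ker[OF that])
  show ?thesis
    unfolding PI_tower_def
  proof (intro conjI allI ballI impI)
    show "\<exists>p. points (W (?v a)) = {p}" if a: "a \<in> Field ?r" "underS ?r a = {}" for a
    proof -
      obtain j where j: "j \<le> n" "a = \<iota> j" using a by (auto simp: F)
      then have "j = 0" using a by (auto simp: uS)
      then show ?thesis using j v triv by simp
    qed
    show "\<phi> (?v a) (?v a) x = x" if "a \<in> Field ?r" "x \<in> points (W (?v a))" for a x
      using that by (auto simp: F v surj \<phi>q)
    show "\<phi> (?v a) (?v b) (\<phi> (?v b) (?v c) x) = \<phi> (?v a) (?v c) x"
      if abc: "(a, b) \<in> ?r \<and> (b, c) \<in> ?r" and x: "x \<in> points (W (?v c))" for a b c x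
    proof -
      obtain i j k where "i \<le> j" "j \<le> k" "k \<le> n" "a = \<iota> i" "b = \<iota> j" "c = \<iota> k"
        using abc by (auto simp: r inj)
      then show ?thesis using x by (auto simp: v surj \<phi>q)
    qed
    show "\<exists>\<eta>\<in>Field ?r. (\<forall>i\<in>Field ?r. (i, \<eta>) \<in> ?r) \<and> W (?v \<eta>) = W n"
      by (rule bexI[of _ "\<iota> n"]) (auto simp: F r v)
    show "proximal_hom G (W (?v b)) (W (?v a)) (\<phi> (?v a) (?v b)) \<or>
        equicontinuous_hom G (W (?v b)) (W (?v a)) (\<phi> (?v a) (?v b))"
      if "successor_in ?r a b" for a b
      using that unfolding succ by (elim exE conjE) (simp add: v step)
  qed (use nolim wo in \<open>auto simp: F r v W intro: hom\<close>)
qed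

text \<open>
  An extension is equicontinuous if a compact space of parameters acts freely along its fibres,
  commuting with the group. Given a neighbourhood \<open>U\<close> of the diagonal, the set \<open>D\<close> of those parameters
  that push some point out of \<open>U\<close> is closed, being the projection of a closed set along a compact
  factor, and avoids the neutral parameter. By freeness the pairs that differ by a parameter in \<open>D\<close> form
  a compact set missing the diagonal, and its complement is the required \<open>\<beta>\<close>: the parameter of a pair is
  unchanged by the group. The space is allowed to be an isomorphic copy \<open>Y\<close> of \<open>X\<close>.
\<close>

lemma equicontinuous_hom_compact_fibres:
  assumes TK: "compact_space TK" and k0: "k0 \<in> topspace TK"
    and cpt: "compact_space (phase X)"
    and m: "continuous_map (prod_topology TK (phase X)) (phase X) (\<lambda>(k, x). m k x)"
    and m1: "\<And>x. x \<in> points X \<Longrightarrow> m k0 x = x"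
    and free: "\<And>k x. \<lbrakk>k \<in> topspace TK; x \<in> points X; m k x = x\<rbrakk> \<Longrightarrow> k = k0"
    and comm: "\<And>g k x. \<lbrakk>g \<in> carrier G; k \<in> topspace TK; x \<in> points X\<rbrakk> \<Longrightarrow>
                 act X g (m k x) = m k (act X g x)"
    and actX: "\<And>g x. \<lbrakk>g \<in> carrier G; x \<in> points X\<rbrakk> \<Longrightarrow> act X g x \<in> points X"
    and T2: "Hausdorff_space (phase Y)"
    and e: "flow_hom G X Y e" "inj_on e (points X)" "points Y = e ` points X"
    and f: "flow_hom G Y Z f"
    and fib: "\<And>x y. \<lbrakk>x \<in> points X; y \<in> points X; f (e x) = f (e y)\<rbrakk> \<Longrightarrow> \<exists>k\<in>topspace TK. y = m k x"
  shows "equicontinuous_hom G Y Z f"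
  unfolding equicontinuous_hom_def
proof (intro conjI allI impI f)
  fix \<alpha> assume "diagonal_nhd (phase Y) \<alpha>"
  then obtain U where U: "openin (prod_topology (phase Y) (phase Y)) U"
    "Id_on (points Y) \<subseteq> U" "U \<subseteq> \<alpha>" by (auto simp: diagonal_nhd_def)
  let ?P = "prod_topology TK (phase X)" and ?Q = "prod_topology (phase Y) (phase Y)"
  let ?h = "\<lambda>(k, x). (e x, e (m k x))"
  have ec: "continuous_map (phase X) (phase Y) e" using e(1) by (simp add: flow_hom_def)
  have h: "continuous_map ?P ?Q ?h"
    using continuous_map_compose[OF continuous_map_snd ec] continuous_map_compose[OF m ec]
    by (auto simp: continuous_map_pairwise o_def case_prod_beta)
  have mX: "m k x \<in> points X" if "k \<in> topspace TK" "x \<in> points X" for k x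
    using continuous_map_image_subset_topspace[OF m] that by (auto simp: image_subset_iff)
  let ?C = "{p \<in> topspace ?P. ?h p \<in> topspace ?Q - U}"
  have "closedin ?P ?C" by (intro closedin_continuous_map_preimage[OF h] closedin_diff closedin_topspace U(1))
  moreover have "closed_map ?P TK fst" by (rule closed_map_fst[OF cpt])
  ultimately have D: "closedin TK (fst ` ?C)" by (auto simp: closed_map_def)
  define D where "D = fst ` ?C"
  have "compactin TK D" using D TK by (simp add: D_def closedin_compact_space)
  then have "compactin ?P (D \<times> points X)"
    using cpt by (simp add: compactin_Times compact_space_def)
  then have "compactin ?Q (?h ` (D \<times> points X))" using h image_compactin by blast
  then have cl: "closedin ?Q (?h ` (D \<times> points X))"
    using T2 compactin_imp_closedin Hausdorff_space_prod_topology by blast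
  define \<beta> where "\<beta> = topspace ?Q - ?h ` (D \<times> points X)"
  have DK: "D \<subseteq> topspace TK" by (auto simp: D_def)
  have "Id_on (points Y) \<subseteq> \<beta>"
  proof
    fix p assume "p \<in> Id_on (points Y)"
    then obtain x where x: "x \<in> points X" "p = (e x, e x)" using e(3) by auto
    have "p \<notin> ?h ` (D \<times> points X)"
    proof
      assume "p \<in> ?h ` (D \<times> points X)"
      then obtain k y where ky: "k \<in> D" "y \<in> points X" "e y = e x" "e (m k y) = e x" using x by auto
      then have "y = x" "m k y = x" using e(2) x mX DK by (auto simp: inj_on_def)
      then have "k = k0" using free ky DK x by auto
      with ky obtain z where z: "z \<in> points X" "(e z, e (m k0 z)) \<notin> U" by (auto simp: D_def)
      then have "(e z, e z) \<notin> U" using m1 by simp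
      then show False using U(2) z e(3) by auto
    qed
    then show "p \<in> \<beta>" using x e(3) by (auto simp: \<beta>_def)
  qed
  moreover have "openin ?Q \<beta>" unfolding \<beta>_def by (intro openin_diff openin_topspace cl)
  ultimately have "diagonal_nhd (phase Y) \<beta>"
    unfolding diagonal_nhd_def by (auto simp: \<beta>_def)
  moreover have "(act Y g a, act Y g b) \<in> \<alpha>"
    if g: "g \<in> carrier G" and ab: "(a, b) \<in> \<beta>" "f a = f b" for g a b
  proof -
    obtain x y where xy: "x \<in> points X" "y \<in> points X" "a = e x" "b = e y"
      using ab e(3) by (auto simp: \<beta>_def)
    then obtain k where k: "k \<in> topspace TK" "y = m k x" using fib ab by auto
    have kD: "k \<notin> D" using ab xy k by (auto simp: \<beta>_def)
    have act: "act Y g (e z) = e (act X g z)" if "z \<in> points X" for z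
      using e(1) g that by (simp add: flow_hom_def)
    have "(e (act X g x), e (m k (act X g x))) \<in> U"
    proof (rule ccontr)
      assume "\<not> ?thesis"
      then have "(k, act X g x) \<in> ?C" using k g xy actX mX e(3) by auto
      then show False using kD by (force simp: D_def)
    qed
    then show ?thesis using U(3) xy k g act comm mX by auto
  qed
  ultimately show "\<exists>\<beta>. diagonal_nhd (phase Y) \<beta> \<and>
      (\<forall>g\<in>carrier G. \<forall>(a, b)\<in>\<beta>. f a = f b \<longrightarrow> (act Y g a, act Y g b) \<in> \<alpha>)"
    by (intro exI[of _ \<beta>]) blast
qed

section \<open>Rays and their directions\<close>

definition dir :: "(real^2) set \<Rightarrow> real^2" where
  "dir R = (SOME u. norm u = 1 \<and> ray u = R)"

definition opp :: "(real^2) set \<Rightarrow> (real^2) set" where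
  "opp R = uminus ` R"

definition cross2 :: "real^2 \<Rightarrow> real^2 \<Rightarrow> real" where
  "cross2 u v = u $ 1 * v $ 2 - u $ 2 * v $ 1"

lemma ray_in_rays [simp]: "v \<noteq> 0 \<Longrightarrow> ray v \<in> rays"
  by (auto simp: rays_def)

lemma ray_sgn: "v \<noteq> 0 \<Longrightarrow> ray (sgn v) = ray v"
  by (simp add: sgn_div_norm ray_scaleR)

lemma dir: 
  assumes "R \<in> rays"
  shows "norm (dir R) = 1" "ray (dir R) = R" "dir R \<noteq> 0"
proof -
  obtain v where "v \<noteq> 0" "R = ray v" using assms by (auto simp: rays_def)
  then have "norm (sgn v) = 1 \<and> ray (sgn v) = R" by (simp add: norm_sgn ray_sgn)
  then have "norm (dir R) = 1 \<and> ray (dir R) = R" unfolding dir_def by (rule someI)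
  then show "norm (dir R) = 1" "ray (dir R) = R" "dir R \<noteq> 0" by auto
qed

lemma dir_ray: "v \<noteq> 0 \<Longrightarrow> dir (ray v) = sgn v"
  using dir[of "ray v"] ray_eq_iff_sgn[of "dir (ray v)" v] by (simp add: sgn_div_norm)

text \<open>
  Membership in a ray becomes an equation between continuous functions, hence a closed condition.
\<close>

lemma in_ray_iff:
  assumes "R \<in> rays" shows "w \<in> R \<longleftrightarrow> w = norm w *\<^sub>R dir R"
proof
  assume "w \<in> R"
  then have "w \<in> ray (dir R)" using dir[OF assms] by simp
  then obtain t where "w = t *\<^sub>R dir R" "t \<ge> 0" by (auto simp: ray_def)
  then show "w = norm w *\<^sub>R dir R" using dir[OF assms] by simp
next
  assume "w = norm w *\<^sub>R dir R"
  then have "w \<in> ray (dir R)" unfolding ray_def using norm_ge_zero by blast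
  then show "w \<in> R" using dir[OF assms] by simp
qed

lemma ray_eq_if_mem: "\<lbrakk>R \<in> rays; w \<in> R; w \<noteq> 0\<rbrakk> \<Longrightarrow> R = ray w"
  by (metis dir(2) in_ray_iff ray_scaleR zero_less_norm_iff)

lemma continuous_map_dir: "continuous_map ray_topology euclidean dir"
proof -
  have "continuous_map (top_of_set (UNIV - {0})) euclidean (dir \<circ> ray)"
    unfolding continuous_map_iff_continuous
    by (rule continuous_on_eq[of _ "\<lambda>v. v /\<^sub>R norm v"])
       (auto intro!: continuous_intros simp: dir_ray sgn_div_norm)
  then show ?thesis using continuous_compose_quotient_map[OF quotient_map_ray] by blast
qed

lemma continuous_map_ray: "continuous_map (top_of_set (UNIV - {0})) ray_topology ray"
  by (simp add: quotient_imp_continuous_map quotient_map_ray)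

lemma compact_space_rays: "compact_space ray_topology"
  using homeomorphic_compact_space[OF ray_topology_homeomorphic_circle]
  by (simp add: compact_space_subtopology)

lemma metrizable_space_rays: "metrizable_space ray_topology"
  using homeomorphic_metrizable_space[OF ray_topology_homeomorphic_circle]
  by (simp add: metrizable_space_subtopology metrizable_space_euclidean)

lemma Hausdorff_space_rays: "Hausdorff_space ray_topology"
  by (simp add: metrizable_imp_Hausdorff_space metrizable_space_rays)

lemma opp_ray: "opp (ray v) = ray (- v)"
  by (force simp: opp_def ray_def)

lemma opp_opp [simp]: "opp (opp R) = R"
  by (simp add: opp_def image_image)

lemma opp_in_rays [simp]: "R \<in> rays \<Longrightarrow> opp R \<in> rays"
  by (auto simp: rays_def opp_ray)

lemma opp_neq: "R \<in> rays \<Longrightarrow> opp R \<noteq> R"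
proof
  assume R: "R \<in> rays" and eq: "opp R = R"
  then have "ray (- dir R) = ray (dir R)" by (metis dir(2) opp_ray)
  then have "sgn (- dir R) = sgn (dir R)" using dir[OF R] by (subst ray_eq_iff_sgn[symmetric]) auto
  then have "- dir R = dir R" using dir[OF R] by (simp add: sgn_div_norm)
  then have "dir R = 0" by (simp add: vec_eq_iff forall_2)
  then show False using dir[OF R] by simp
qed

lemma dir_opp: "R \<in> rays \<Longrightarrow> dir (opp R) = - dir R"
  using dir_ray[of "- dir R"] dir[of R] by (simp add: opp_ray[symmetric] sgn_div_norm)

lemma dir_inj: "\<lbrakk>R \<in> rays; S \<in> rays; dir R = dir S\<rbrakk> \<Longrightarrow> R = S"
  by (metis dir(2))

lemma continuous_map_opp: "continuous_map ray_topology ray_topology opp"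
proof -
  have "continuous_map ray_topology (top_of_set (UNIV - {0})) (\<lambda>R. - dir R)"
    using continuous_map_dir dir(3)
    by (auto simp: continuous_map_in_subtopology intro!: continuous_map_minus)
  from continuous_map_compose[OF this continuous_map_ray] show ?thesis
    by (rule continuous_map_eq) (metis comp_apply dir(2) opp_ray topspace_ray_topology)
qed

lemma cross2_0_imp_multiple:
  fixes u w :: "real^2"
  assumes "cross2 u w = 0" "u \<noteq> 0"
  shows "\<exists>c. w = c *\<^sub>R u"
proof (cases "u $ 1 = 0")
  case True
  then have "u $ 2 \<noteq> 0" using assms(2) by (auto simp: vec_eq_iff forall_2)
  then show ?thesis using assms True
    by (intro exI[of _ "w $ 2 / u $ 2"]) (auto simp: vec_eq_iff forall_2 cross2_def)
next
  case False
  then show ?thesis using assms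
    by (intro exI[of _ "w $ 1 / u $ 1"]) (auto simp: vec_eq_iff forall_2 cross2_def field_simps)
qed

lemma rays_parallel:
  assumes "R \<in> rays" "S \<in> rays" "cross2 (dir R) (dir S) = 0"
  shows "S = R \<or> S = opp R"
proof -
  obtain c where c: "dir S = c *\<^sub>R dir R" using cross2_0_imp_multiple assms dir by metis
  then have "\<bar>c\<bar> = 1" using dir[OF assms(1)] dir[OF assms(2)] by (metis mult.right_neutral norm_scaleR)
  then have "dir S = dir R \<or> dir S = dir (opp R)" using c dir_opp[OF assms(1)] by (auto simp: abs_if split: if_splits)
  then show ?thesis using dir_inj[OF assms(2)] assms(1) opp_in_rays by metis
qed

section \<open>The group and its action on rays\<close>

text \<open>
  The adjugate. It is the inverse for determinant one, and visibly continuous.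
\<close>

definition adj2 :: "real^2^2 \<Rightarrow> real^2^2" where
  "adj2 A = vector [vector [A $ 2 $ 2, - A $ 1 $ 2], vector [- A $ 2 $ 1, A $ 1 $ 1]]"

lemma adj2:
  assumes "det A = 1"
  shows "adj2 A ** A = mat 1" "A ** adj2 A = mat 1" "det (adj2 A) = 1"
  using assms
  by (auto simp: adj2_def vec_eq_iff forall_2 matrix_matrix_mult_def sum_2 mat_def det_2 algebra_simps)

lemma group_SL2: "group SL2"
proof (rule groupI)
  fix A assume "A \<in> carrier SL2"
  then show "\<exists>B\<in>carrier SL2. B \<otimes>\<^bsub>SL2\<^esub> A = \<one>\<^bsub>SL2\<^esub>"
    by (intro bexI[of _ "adj2 A"]) (auto simp: SL2_def adj2)
qed (auto simp: SL2_def det_mul matrix_mul_assoc)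

lemma inv_SL2: "A \<in> carrier SL2 \<Longrightarrow> inv\<^bsub>SL2\<^esub> A = adj2 A"
  by (rule group.inv_equality[OF group_SL2]) (auto simp: SL2_def adj2)

lemma topological_group_SL2: "topological_group SL2 SL2_topology"
proof -
  have "continuous_on UNIV (\<lambda>(A, B). A ** (B :: real^2^2))"
    unfolding matrix_matrix_mult_def case_prod_beta by (intro continuous_intros)
  then have "continuous_map (prod_topology SL2_topology SL2_topology) SL2_topology (\<lambda>(A, B). A \<otimes>\<^bsub>SL2\<^esub> B)"
    unfolding SL2_topology_def prod_topology_subtopology_eu continuous_map_subtopology_eu
    by (auto simp: SL2_def det_mul intro: continuous_on_subset)
  moreover have "continuous_on (carrier SL2) adj2"
  proof -
    have "adj2 = (\<lambda>A. \<chi> i j. if i = 1 then (if j = 1 then A $ 2 $ 2 else - A $ 1 $ 2)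
        else (if j = 1 then - A $ 2 $ 1 else A $ 1 $ 1))"
      by (auto simp: fun_eq_iff adj2_def vec_eq_iff forall_2)
    moreover have "continuous_on UNIV \<dots>"
    proof (intro continuous_on_vec_lambda)
      fix i j :: 2
      show "continuous_on UNIV (\<lambda>A :: real^2^2. if i = 1 then (if j = 1 then A $ 2 $ 2 else - A $ 1 $ 2)
          else (if j = 1 then - A $ 2 $ 1 else A $ 1 $ 1))"
        by (cases "i = 1"; cases "j = 1") (auto intro!: continuous_intros)
    qed
    ultimately show ?thesis by (metis continuous_on_subset subset_UNIV)
  qed
  then have "continuous_map SL2_topology SL2_topology adj2"
    unfolding SL2_topology_def continuous_map_subtopology_eu by (auto simp: SL2_def adj2)
  then have "continuous_map SL2_topology SL2_topology (\<lambda>A. inv\<^bsub>SL2\<^esub> A)"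
    by (rule continuous_map_eq) (simp add: SL2_topology_def inv_SL2)
  ultimately show ?thesis
    by (simp add: topological_group_def group_SL2 SL2_topology_def)
qed

lemma topological_group_power:
  assumes "topological_group G TG"
  shows "topological_group (product_group UNIV (\<lambda>_ :: nat. G)) (product_topology (\<lambda>_. TG) UNIV)"
proof -
  let ?P = "product_topology (\<lambda>_ :: nat. TG) UNIV"
  have G: "group G" and top: "topspace TG = carrier G"
    and m: "continuous_map (prod_topology TG TG) TG (\<lambda>(g, h). g \<otimes>\<^bsub>G\<^esub> h)"
    and i: "continuous_map TG TG (\<lambda>g. inv\<^bsub>G\<^esub> g)"
    using assms by (auto simp: topological_group_def)
  have "continuous_map (prod_topology ?P ?P) ?P (\<lambda>(g, h) n. g n \<otimes>\<^bsub>G\<^esub> h n)"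
    unfolding continuous_map_componentwise_UNIV
  proof
    fix n
    have "continuous_map (prod_topology ?P ?P) (prod_topology TG TG) (\<lambda>p. (fst p n, snd p n))"
      using continuous_map_compose[OF continuous_map_fst continuous_map_product_projection, of n UNIV]
        continuous_map_compose[OF continuous_map_snd continuous_map_product_projection, of n UNIV]
      by (auto simp: continuous_map_pairwise o_def)
    from continuous_map_compose[OF this m]
    show "continuous_map (prod_topology ?P ?P) TG (\<lambda>p. (case p of (g, h) \<Rightarrow> \<lambda>n. g n \<otimes>\<^bsub>G\<^esub> h n) n)"
      by (simp add: o_def case_prod_unfold)
  qed
  moreover have "continuous_map ?P ?P (\<lambda>g. inv\<^bsub>product_group UNIV (\<lambda>_. G)\<^esub> g)"
  proof (rule continuous_map_eq)
    show "continuous_map ?P ?P (\<lambda>g n. inv\<^bsub>G\<^esub> g n)"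
      unfolding continuous_map_componentwise_UNIV
      using continuous_map_compose[OF continuous_map_product_projection[of _ UNIV "\<lambda>_. TG"] i]
      by (auto simp: o_def)
    fix g assume "g \<in> topspace ?P"
    then have "g \<in> (\<Pi>\<^sub>E n\<in>UNIV. carrier G)" by (simp add: top o_def)
    then show "(\<lambda>n. inv\<^bsub>G\<^esub> g n) = inv\<^bsub>product_group UNIV (\<lambda>_. G)\<^esub> g"
      using G by (simp add: restrict_def)
  qed
  ultimately show ?thesis
    using G by (simp add: topological_group_def top o_def restrict_def)
qed

lemma act_ray: "v \<noteq> 0 \<Longrightarrow> act ray_flow A (ray v) = ray (A *v v)"
proof -
  assume "v \<noteq> 0"
  then have "act ray_flow A (ray v) = (*v) A ` ray v" by (simp add: ray_flow_def)
  then show ?thesis by (force simp: ray_def matrix_vector_mult_scaleR)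
qed

lemma SL2_nonzero: "\<lbrakk>A \<in> carrier SL2; v \<noteq> 0\<rbrakk> \<Longrightarrow> A *v v \<noteq> 0"
  using adj2(1)[of A] by (metis (mono_tags) SL2_def matrix_vector_mul_assoc matrix_vector_mul_lid
      matrix_vector_mult_0_right mem_Collect_eq partial_object.select_convs(1))

lemma act_rays: "\<lbrakk>A \<in> carrier SL2; R \<in> rays\<rbrakk> \<Longrightarrow> act ray_flow A R \<in> rays"
  by (auto simp: rays_def act_ray SL2_nonzero)

lemma act_dir: "R \<in> rays \<Longrightarrow> act ray_flow A R = ray (A *v dir R)"
  by (metis act_ray dir(2,3))

lemma act_opp: "R \<in> rays \<Longrightarrow> act ray_flow A (opp R) = opp (act ray_flow A R)"
  by (auto simp: rays_def act_ray opp_ray linear_neg[OF matrix_vector_mul_linear])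

lemma act_mult: "\<lbrakk>A \<in> carrier SL2; B \<in> carrier SL2; R \<in> rays\<rbrakk> \<Longrightarrow>
    act ray_flow (A \<otimes>\<^bsub>SL2\<^esub> B) R = act ray_flow A (act ray_flow B R)"
proof -
  assume AB: "A \<in> carrier SL2" "B \<in> carrier SL2" and "R \<in> rays"
  then obtain v where v: "v \<noteq> 0" "R = ray v" by (auto simp: rays_def)
  moreover have "(A \<otimes>\<^bsub>SL2\<^esub> B) *v v = A *v (B *v v)"
    by (simp add: SL2_def matrix_vector_mul_assoc)
  ultimately show ?thesis using AB by (simp add: act_ray SL2_nonzero)
qed

lemma act_one: "R \<in> rays \<Longrightarrow> act ray_flow \<one>\<^bsub>SL2\<^esub> R = R"
  by (auto simp: rays_def act_ray SL2_def)

lemma continuous_map_act_ray: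
  "continuous_map (prod_topology SL2_topology ray_topology) ray_topology (\<lambda>(A, R). act ray_flow A R)"
proof -
  let ?P = "prod_topology SL2_topology ray_topology"
  have "continuous_map ?P euclidean fst"
    unfolding SL2_topology_def by (meson continuous_map_fst continuous_map_into_fulltopology)
  moreover have "continuous_map ?P euclidean (\<lambda>p. dir (snd p))"
    using continuous_map_compose[OF continuous_map_snd continuous_map_dir] by (simp add: o_def)
  ultimately have "continuous_map ?P euclidean (\<lambda>p. (fst p, dir (snd p)))"
    by (simp add: continuous_map_pairwise o_def flip: prod_topology_euclidean)
  moreover have "continuous_map euclidean euclidean (\<lambda>(A, v). A *v (v :: real^2) :: real^2)"
    unfolding matrix_vector_mult_def case_prod_beta continuous_map_iff_continuous2
    by (intro continuous_intros)
  ultimately have "continuous_map ?P euclidean ((\<lambda>(A, v). A *v v) \<circ> (\<lambda>p. (fst p, dir (snd p))))"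
    by (rule continuous_map_compose)
  then have "continuous_map ?P euclidean (\<lambda>p. fst p *v dir (snd p))"
    by (simp add: o_def)
  then have "continuous_map ?P (top_of_set (UNIV - {0})) (\<lambda>p. fst p *v dir (snd p))"
    by (auto simp: continuous_map_in_subtopology SL2_topology_def SL2_nonzero dir)
  from continuous_map_compose[OF this continuous_map_ray] show ?thesis
    by (rule continuous_map_eq) (auto simp: act_dir)
qed

text \<open>
  The rotation taking one direction to the other has determinant one.
\<close>

lemma SL2_transitive:
  assumes "R \<in> rays" "S \<in> rays"
  shows "\<exists>A\<in>carrier SL2. act ray_flow A R = S"
proof -
  define u w c s where "u = dir R" and "w = dir S" and "c = u $ 1 * w $ 1 + u $ 2 * w $ 2" and "s = cross2 u w"
  define A :: "real^2^2" where "A = vector [vector [c, - s], vector [s, c]]"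
  have n: "u $ 1 * u $ 1 + u $ 2 * u $ 2 = 1" "w $ 1 * w $ 1 + w $ 2 * w $ 2 = 1"
    using dir(1)[OF assms(1)] dir(1)[OF assms(2)]
    by (simp_all add: u_def w_def norm_vec_def L2_set_def sum_2 power2_eq_square)
  have "det A = (u $ 1 * u $ 1 + u $ 2 * u $ 2) * (w $ 1 * w $ 1 + w $ 2 * w $ 2)"
    by (simp add: A_def det_2 c_def s_def cross2_def algebra_simps)
  then have "A \<in> carrier SL2" using n by (simp add: SL2_def)
  moreover have "A *v u = (u $ 1 * u $ 1 + u $ 2 * u $ 2) *\<^sub>R w"
    by (simp add: vec_eq_iff forall_2 A_def matrix_vector_mult_def sum_2 c_def s_def cross2_def algebra_simps)
  ultimately show ?thesis using n assms by (metis act_dir dir(2) scaleR_one u_def w_def)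
qed

section \<open>Shears and their limits\<close>

text \<open>
  The half-open half circle that starts at \<open>R\<close>, included, and runs counterclockwise to the opposite
  ray, excluded.
\<close>

definition side :: "(real^2) set \<Rightarrow> (real^2) set \<Rightarrow> bool" where
  "side R S \<longleftrightarrow> cross2 (dir R) (dir S) > 0 \<or> S = R"

text \<open>
  The parabolic subgroup fixing \<open>R\<close>: a vector \<open>w\<close> moves in the direction of \<open>R\<close> at a speed
  proportional to its signed distance from the line of \<open>R\<close>; see \<open>shear_mult\<close> below.
\<close>

definition shear :: "(real^2) set \<Rightarrow> real \<Rightarrow> real^2^2" where
  "shear R t = (\<chi> i j. (if i = j then 1 else 0) +
     t * dir R $ i * (if j = 1 then - dir R $ 2 else dir R $ 1))"

lemma shear_SL2: "shear R t \<in> carrier SL2"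
  by (simp add: shear_def SL2_def det_2 algebra_simps)

lemma shear_mult: "shear R t *v w = w + (t * cross2 (dir R) w) *\<^sub>R dir R"
  by (simp add: shear_def vec_eq_iff forall_2 matrix_vector_mult_def sum_2 cross2_def algebra_simps)

text \<open>
  The component in the direction of \<open>R\<close> outgrows everything else, with the sign of the signed
  distance, while \<open>R\<close> and its opposite stay put. This is why the half circle is half-open and the
  limit has values in \<open>R\<close> and its opposite only.
\<close>

lemma limitin_shear:
  assumes R: "R \<in> rays" and S: "S \<in> rays"
  shows "limitin ray_topology (\<lambda>n. act ray_flow (shear R (real n)) S)
           (if side R S then R else opp R) sequentially"
proof (cases "cross2 (dir R) (dir S) = 0")
  case True
  then have "act ray_flow (shear R t) S = S" for t
    using S by (simp add: act_dir shear_mult dir)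
  moreover have "S = (if side R S then R else opp R)"
    using rays_parallel[OF R S True] opp_neq[OF R] True by (auto simp: side_def)
  ultimately show ?thesis using S R by (intro limitin_eventually) auto
next
  case False
  let ?d = "cross2 (dir R) (dir S)"
  have "(\<lambda>n. inverse (real n) *\<^sub>R dir S + ?d *\<^sub>R dir R) \<longlonglongrightarrow> 0 *\<^sub>R dir S + ?d *\<^sub>R dir R"
    by (intro tendsto_intros lim_inverse_n)
  then have lim: "(\<lambda>n. inverse (real n) *\<^sub>R dir S + ?d *\<^sub>R dir R) \<longlonglongrightarrow> ?d *\<^sub>R dir R"
    by simp
  have nz: "?d *\<^sub>R dir R \<noteq> 0" using False dir[OF R] by simp
  have op: "open (UNIV - {0 :: real^2})" by (simp add: open_delete)
  have "limitin (top_of_set (UNIV - {0})) (\<lambda>n. inverse (real n) *\<^sub>R dir S + ?d *\<^sub>R dir R) (?d *\<^sub>R dir R) sequentially"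
    using lim nz by (simp add: limitin_canonical_iff_gen[OF op])
  from continuous_map_limit[OF continuous_map_ray this]
  have L: "limitin ray_topology (\<lambda>n. ray (inverse (real n) *\<^sub>R dir S + ?d *\<^sub>R dir R)) (ray (?d *\<^sub>R dir R)) sequentially"
    by (simp add: o_def)
  have ev: "eventually (\<lambda>n. act ray_flow (shear R (real n)) S = ray (inverse (real n) *\<^sub>R dir S + ?d *\<^sub>R dir R)) sequentially"
  proof (rule eventually_sequentiallyI[of 1])
    fix n :: nat assume "n \<ge> 1"
    then have "shear R (real n) *v dir S = real n *\<^sub>R (inverse (real n) *\<^sub>R dir S + ?d *\<^sub>R dir R)"
      by (simp add: shear_mult scaleR_add_right)
    then show "act ray_flow (shear R (real n)) S = ray (inverse (real n) *\<^sub>R dir S + ?d *\<^sub>R dir R)"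
      using \<open>n \<ge> 1\<close> S by (simp add: act_dir ray_scaleR)
  qed
  have "ray (?d *\<^sub>R dir R) = (if side R S then R else opp R)"
  proof (cases "?d > 0")
    case True
    then show ?thesis using R by (simp add: side_def ray_scaleR dir)
  next
    case neg: False
    then have "ray (?d *\<^sub>R dir R) = ray (- dir R)"
      using False ray_scaleR[of "- ?d" "- dir R"] by simp
    moreover have "\<not> side R S" using neg False by (auto simp: side_def cross2_def)
    ultimately show ?thesis using R by (metis dir(2) opp_ray)
  qed
  then show ?thesis using L ev
    by (simp add: limitin_def) (smt (verit) eventually_elim2)
qed

section \<open>The product flow\<close>

lemma phase_Omega: "phase Omega = product_topology (\<lambda>_. ray_topology) UNIV"
  by (simp add: Omega_def power_flow_def Let_def ray_flow_def)

lemma points_Omega: "\<omega> \<in> points Omega \<longleftrightarrow> (\<forall>n. \<omega> n \<in> rays)"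
  by (auto simp: phase_Omega PiE_UNIV_domain)

lemma act_Omega: "\<omega> \<in> points Omega \<Longrightarrow> act Omega g \<omega> = (\<lambda>n. act ray_flow (g n) (\<omega> n))"
  by (simp add: Omega_def power_flow_def Let_def)

lemma act_Omega_extensional: "act Omega g \<in> extensional (points Omega)"
  by (simp add: Omega_def power_flow_def Let_def)

lemma carrier_SL2_power: "g \<in> carrier SL2_power \<longleftrightarrow> (\<forall>n. g n \<in> carrier SL2)"
  by (auto simp: SL2_power_def PiE_UNIV_domain)

lemma topological_group_SL2_power: "topological_group SL2_power SL2_power_topology"
  unfolding SL2_power_def SL2_power_topology_def
  by (rule topological_group_power[OF topological_group_SL2])

lemma continuous_map_act_Omega:
  "continuous_map (prod_topology SL2_power_topology (phase Omega)) (phase Omega) (\<lambda>(g, \<omega>). act Omega g \<omega>)"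
proof (rule continuous_map_eq)
  let ?P = "prod_topology SL2_power_topology (phase Omega)"
  show "continuous_map ?P (phase Omega) (\<lambda>(g, \<omega>) n. act ray_flow (g n) (\<omega> n))"
    unfolding phase_Omega continuous_map_componentwise_UNIV
  proof
    fix n
    have "continuous_map ?P SL2_topology (\<lambda>p. fst p n)"
      using continuous_map_compose[OF continuous_map_fst continuous_map_product_projection[of n UNIV "\<lambda>_. SL2_topology"]]
      by (simp add: SL2_power_topology_def o_def)
    moreover have "continuous_map ?P ray_topology (\<lambda>p. snd p n)"
      using continuous_map_compose[OF continuous_map_snd continuous_map_product_projection[of n UNIV "\<lambda>_. ray_topology"]]
      by (simp add: phase_Omega o_def)
    ultimately have "continuous_map ?P (prod_topology SL2_topology ray_topology) (\<lambda>p. (fst p n, snd p n))"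
      by (simp add: continuous_map_pairwise o_def)
    from continuous_map_compose[OF this continuous_map_act_ray]
    show "continuous_map (prod_topology SL2_power_topology (product_topology (\<lambda>_. ray_topology) UNIV)) ray_topology
        (\<lambda>p. (case p of (g, \<omega>) \<Rightarrow> \<lambda>n. act ray_flow (g n) (\<omega> n)) n)"
      by (simp add: o_def case_prod_unfold phase_Omega)
  qed
qed (auto simp: act_Omega)

lemma compact_space_Omega: "compact_space (phase Omega)"
  by (simp add: phase_Omega compact_space_product_topology compact_space_rays)

lemma metrizable_space_Omega: "metrizable_space (phase Omega)"
  by (simp add: phase_Omega metrizable_space_product_topology metrizable_space_rays)

lemma Hausdorff_space_Omega: "Hausdorff_space (phase Omega)"
  by (simp add: metrizable_imp_Hausdorff_space metrizable_space_Omega)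

lemma const_in_Omega: "R \<in> rays \<Longrightarrow> (\<lambda>n. R) \<in> points Omega"
  by (simp add: points_Omega)

lemma is_flow_Omega: "is_flow SL2_power SL2_power_topology Omega"
proof (rule is_flowI[OF topological_group_SL2_power compact_space_Omega Hausdorff_space_Omega
      _ act_Omega_extensional _ _ continuous_map_act_Omega])
  show "points Omega \<noteq> {}"
    using const_in_Omega[of "ray (axis 1 1)"] by (auto simp: axis_eq_0_iff)
  fix \<omega> assume \<omega>: "\<omega> \<in> points Omega"
  then show "act Omega \<one>\<^bsub>SL2_power\<^esub> \<omega> = \<omega>"
    by (simp add: act_Omega SL2_power_def act_one points_Omega)
  fix g h assume "g \<in> carrier SL2_power" "h \<in> carrier SL2_power"
  then show "act Omega (g \<otimes>\<^bsub>SL2_power\<^esub> h) \<omega> = act Omega g (act Omega h \<omega>)"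
    using \<omega> by (simp add: act_Omega carrier_SL2_power points_Omega act_rays) (simp add: SL2_power_def act_mult)
qed

lemmas act_Omega_props = flow_act[OF is_flow_Omega]

text \<open>
  Transitivity holds coordinatewise, and the full product group allows the coordinates to be moved
  independently.
\<close>

lemma Omega_transitive:
  assumes "\<omega> \<in> points Omega" "\<omega>' \<in> points Omega"
  shows "\<exists>g\<in>carrier SL2_power. act Omega g \<omega> = \<omega>'"
proof -
  have "\<forall>n. \<exists>A. A \<in> carrier SL2 \<and> act ray_flow A (\<omega> n) = \<omega>' n"
    using SL2_transitive assms by (meson points_Omega)
  then obtain g where "\<forall>n. g n \<in> carrier SL2 \<and> act ray_flow (g n) (\<omega> n) = \<omega>' n" by metis
  then show ?thesis using assms by (intro bexI[of _ g]) (auto simp: act_Omega carrier_SL2_power)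
qed

lemma minimal_flow_Omega: "minimal_flow SL2_power SL2_power_topology Omega"
  unfolding minimal_flow_def
proof (intro conjI ballI is_flow_Omega)
  fix \<omega> assume "\<omega> \<in> points Omega"
  then have "orbit SL2_power (act Omega) \<omega> = points Omega"
    using Omega_transitive act_Omega_props(1) by (fastforce simp: orbit_def)
  then show "phase Omega closure_of orbit SL2_power (act Omega) \<omega> = points Omega" by simp
qed

text \<open>
  The compact group of sign sequences acts freely on the product and commutes with the group action;
  its orbits are the fibres of the map to sequences of lines.
\<close>

definition flip :: "(nat \<Rightarrow> bool) \<Rightarrow> (nat \<Rightarrow> (real^2) set) \<Rightarrow> nat \<Rightarrow> (real^2) set" where
  "flip \<epsilon> \<omega> = (\<lambda>n. if \<epsilon> n then \<omega> n else opp (\<omega> n))"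

abbreviation signs :: "(nat \<Rightarrow> bool) topology" where
  "signs \<equiv> product_topology (\<lambda>_. discrete_topology UNIV) UNIV"

lemma flip_in_Omega [simp]: "\<omega> \<in> points Omega \<Longrightarrow> flip \<epsilon> \<omega> \<in> points Omega"
  by (auto simp: flip_def points_Omega)

lemma act_flip: "\<omega> \<in> points Omega \<Longrightarrow> act Omega g (flip \<epsilon> \<omega>) = flip \<epsilon> (act Omega g \<omega>)"
  using flip_in_Omega[of \<omega> \<epsilon>] by (auto simp: act_Omega flip_def act_opp points_Omega fun_eq_iff)

lemma continuous_map_flip: "continuous_map (prod_topology signs (phase Omega)) (phase Omega) (\<lambda>(\<epsilon>, \<omega>). flip \<epsilon> \<omega>)"
  unfolding phase_Omega continuous_map_componentwise_UNIV
proof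
  fix n
  let ?P = "prod_topology signs (product_topology (\<lambda>_ :: nat. ray_topology) UNIV)"
  have c: "continuous_map ?P ray_topology (\<lambda>p. snd p n)"
    using continuous_map_compose[OF continuous_map_snd continuous_map_product_projection[of n UNIV "\<lambda>_. ray_topology"]]
    by (simp add: o_def)
  have d: "continuous_map ?P (discrete_topology UNIV) (\<lambda>p. fst p n)"
    using continuous_map_compose[OF continuous_map_fst continuous_map_product_projection[of n UNIV "\<lambda>_. discrete_topology (UNIV :: bool set)"]]
    by (simp add: o_def)
  show "continuous_map ?P ray_topology (\<lambda>p. (case p of (\<epsilon>, \<omega>) \<Rightarrow> flip \<epsilon> \<omega>) n)"
  proof -
    have "continuous_map ?P ray_topology (\<lambda>p. if fst p n \<in> {True} then snd p n else opp (snd p n))"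
    proof (rule continuous_map_cases_function[OF d])
      show "continuous_map (subtopology ?P S) ray_topology (\<lambda>p. snd p n)" for S
        using c by (rule continuous_map_from_subtopology)
      show "continuous_map (subtopology ?P S) ray_topology (\<lambda>p. opp (snd p n))" for S
        using continuous_map_compose[OF c continuous_map_opp]
        by (intro continuous_map_from_subtopology) (simp add: o_def)
    qed (simp add: discrete_topology_frontier_of)
    then show ?thesis by (simp add: flip_def case_prod_unfold)
  qed
qed

lemma flip_eq_self: "\<lbrakk>\<omega> \<in> points Omega; flip \<epsilon> \<omega> = \<omega>\<rbrakk> \<Longrightarrow> \<epsilon> = (\<lambda>_. True)"
  by (metis flip_def opp_neq points_Omega)

definition shear_limit :: "(nat \<Rightarrow> (real^2) set) \<Rightarrow> (nat \<Rightarrow> (real^2) set) \<Rightarrow> nat \<Rightarrow> (real^2) set" where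
  "shear_limit v = (\<lambda>\<omega>\<in>points Omega. flip (\<lambda>n. side (v n) (\<omega> n)) v)"

abbreviation shears :: "(nat \<Rightarrow> (real^2) set) \<Rightarrow> nat \<Rightarrow> nat \<Rightarrow> real^2^2" where
  "shears v k \<equiv> \<lambda>n. shear (v n) (real k)"

lemma shears_carrier: "shears v k \<in> carrier SL2_power"
  by (simp add: carrier_SL2_power shear_SL2)

lemma limitin_shears:
  assumes "v \<in> points Omega" "\<omega> \<in> points Omega"
  shows "limitin (phase Omega) (\<lambda>k. act Omega (shears v k) \<omega>) (shear_limit v \<omega>) sequentially"
  unfolding phase_Omega limitin_componentwise
proof (intro conjI ballI)
  show "\<forall>\<^sub>F k in sequentially. act Omega (shears v k) \<omega> \<in> topspace (product_topology (\<lambda>_. ray_topology) UNIV)"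
    using act_Omega_props(1)[OF shears_carrier assms(2)] by (simp add: phase_Omega)
  fix n
  show "limitin ray_topology (\<lambda>k. act Omega (shears v k) \<omega> n) (shear_limit v \<omega> n) sequentially"
    using limitin_shear assms by (simp add: act_Omega shear_limit_def flip_def points_Omega)
qed auto

section \<open>The flow of sequences of lines\<close>

definition lines :: "(nat \<Rightarrow> (real^2) set) \<Rightarrow> nat \<Rightarrow> (real^2) set" where
  "lines \<omega> = (\<lambda>n. \<omega> n \<union> opp (\<omega> n))"

text \<open>
  The orthogonal projections onto the lines: a continuous function into a Hausdorff space that
  separates exactly the sequences of lines, from which the factor of lines gets its topology.
\<close>

definition line_projections :: "(nat \<Rightarrow> (real^2) set) \<Rightarrow> nat \<Rightarrow> real^2^2" where
  "line_projections \<omega> = (\<lambda>n. \<chi> i j. dir (\<omega> n) $ i * dir (\<omega> n) $ j)"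

lemma line_eq_iff:
  assumes "R \<in> rays" "S \<in> rays"
  shows "R \<union> opp R = S \<union> opp S \<longleftrightarrow> S = R \<or> S = opp R"
proof
  assume "R \<union> opp R = S \<union> opp S"
  moreover have "dir S \<in> S" using assms dir[OF assms(2)] by (simp add: in_ray_iff)
  ultimately have "dir S \<in> R \<or> dir S \<in> opp R" by blast
  then show "S = R \<or> S = opp R"
    using ray_eq_if_mem[of R "dir S"] ray_eq_if_mem[of "opp R" "dir S"] dir[OF assms(2)] assms by auto
qed auto

lemma lines_eq_iff:
  assumes "\<omega> \<in> points Omega" "\<omega>' \<in> points Omega"
  shows "lines \<omega> = lines \<omega>' \<longleftrightarrow> (\<exists>\<epsilon>. \<omega>' = flip \<epsilon> \<omega>)"
proof -
  have "lines \<omega> = lines \<omega>' \<longleftrightarrow> (\<forall>n. \<omega>' n = \<omega> n \<or> \<omega>' n = opp (\<omega> n))"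
    using assms line_eq_iff by (auto simp: lines_def fun_eq_iff points_Omega)
  also have "\<dots> \<longleftrightarrow> (\<exists>\<epsilon>. \<omega>' = flip \<epsilon> \<omega>)"
    by (auto simp: flip_def fun_eq_iff intro: exI[of _ "\<lambda>n. \<omega>' n = \<omega> n"])
  finally show ?thesis .
qed

lemma lines_flip [simp]: "\<omega> \<in> points Omega \<Longrightarrow> lines (flip \<epsilon> \<omega>) = lines \<omega>"
  by (metis flip_in_Omega lines_eq_iff)

lemma lines_act:
  "\<lbrakk>\<omega> \<in> points Omega; \<omega>' \<in> points Omega; lines \<omega> = lines \<omega>'; g \<in> carrier SL2_power\<rbrakk> \<Longrightarrow>
     lines (act Omega g \<omega>) = lines (act Omega g \<omega>')"
  using act_Omega_props(1)[of g \<omega>] by (auto simp: lines_eq_iff act_flip)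

text \<open>
  Equality of the two projections makes the squared cross product of the directions vanish.
\<close>

lemma projection_eq_iff:
  assumes "R \<in> rays" "S \<in> rays"
  shows "(\<chi> i j. dir R $ i * dir R $ j) = (\<chi> i j. dir S $ i * dir S $ j) \<longleftrightarrow> S = R \<or> S = opp R"
proof
  let ?u = "dir R" and ?w = "dir S"
  assume "(\<chi> i j. ?u $ i * ?u $ j) = (\<chi> i j. ?w $ i * ?w $ j)"
  then have eq: "?u $ i * ?u $ j = ?w $ i * ?w $ j" for i j
    by (simp add: vec_eq_iff)
  have "cross2 ?u ?w * cross2 ?u ?w =
      (?u $ 1 * ?u $ 1) * (?w $ 2 * ?w $ 2) - 2 * (?u $ 1 * ?u $ 2) * (?w $ 1 * ?w $ 2) + (?u $ 2 * ?u $ 2) * (?w $ 1 * ?w $ 1)"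
    by (simp add: cross2_def algebra_simps)
  also have "\<dots> = 0"
    unfolding eq by (simp add: algebra_simps)
  finally show "S = R \<or> S = opp R" using rays_parallel assms by simp
qed (use assms in \<open>auto simp: dir_opp\<close>)

lemma line_projections_eq_iff:
  assumes "\<omega> \<in> points Omega" "\<omega>' \<in> points Omega"
  shows "line_projections \<omega> = line_projections \<omega>' \<longleftrightarrow> lines \<omega> = lines \<omega>'"
  using assms projection_eq_iff line_eq_iff
  by (simp add: line_projections_def lines_def fun_eq_iff points_Omega)

lemma continuous_map_line_projections:
  "continuous_map (phase Omega) (product_topology (\<lambda>_. euclidean) UNIV) line_projections"
  unfolding phase_Omega continuous_map_componentwise_UNIV
proof
  fix n
  have "continuous_on UNIV (\<lambda>u :: real^2. \<chi> i j. u $ i * u $ j)"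
    by (intro continuous_intros)
  then have "continuous_map euclidean euclidean (\<lambda>u :: real^2. \<chi> i j. u $ i * u $ j)" by simp
  from continuous_map_compose[OF continuous_map_compose[OF continuous_map_product_projection[of n UNIV "\<lambda>_. ray_topology"]
        continuous_map_dir] this]
  show "continuous_map (product_topology (\<lambda>_. ray_topology) UNIV) euclidean (\<lambda>\<omega>. line_projections \<omega> n)"
    by (simp add: o_def line_projections_def)
qed

section \<open>Point, lines, rays: the tower\<close>

text \<open>
  The three levels are the one-point flow, the sequences of lines and the sequences of rays. The
  encoding \<open>e\<close> allows the whole tower to be placed inside another type; it must be injective on
  sequences of rays and on sequences of lines. The point at the bottom is an arbitrary default value.
\<close>

definition level_map :: "((nat \<Rightarrow> (real^2) set) \<Rightarrow> 'w) \<Rightarrow> nat \<Rightarrow> (nat \<Rightarrow> (real^2) set) \<Rightarrow> 'w" where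
  "level_map e i = (if i = 0 then (\<lambda>_. undefined) else if i = 1 then e \<circ> lines else e)"

definition level :: "((nat \<Rightarrow> (real^2) set) \<Rightarrow> 'w) \<Rightarrow> nat \<Rightarrow> (nat \<Rightarrow> real^2^2, 'w) flow" where
  "level e i =
     (if i = 0 then factor_flow Omega (discrete_topology (UNIV :: unit set)) (\<lambda>_. ()) (level_map e 0)
      else if i = 1 then factor_flow Omega (product_topology (\<lambda>_. euclidean) UNIV) line_projections (level_map e 1)
      else factor_flow Omega (phase Omega) id (level_map e 2))"

context
  fixes e :: "(nat \<Rightarrow> (real^2) set) \<Rightarrow> 'w"
  assumes inj: "inj_on e {\<omega>. \<forall>n. \<omega> n \<noteq> {}}"
begin

lemma level_map_eq_iff:
  assumes "\<omega> \<in> points Omega" "\<omega>' \<in> points Omega"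
  shows "level_map e (Suc 0) \<omega> = level_map e (Suc 0) \<omega>' \<longleftrightarrow> lines \<omega> = lines \<omega>'"
    and "level_map e 2 \<omega> = level_map e 2 \<omega>' \<longleftrightarrow> \<omega> = \<omega>'"
proof -
  have ne: "R \<noteq> {}" if "R \<in> rays" for R using that by (auto simp: rays_def ray_def)
  then have "\<omega> \<in> {\<omega>. \<forall>n. \<omega> n \<noteq> {}}" "\<omega>' \<in> {\<omega>. \<forall>n. \<omega> n \<noteq> {}}"
    "lines \<omega> \<in> {\<omega>. \<forall>n. \<omega> n \<noteq> {}}" "lines \<omega>' \<in> {\<omega>. \<forall>n. \<omega> n \<noteq> {}}"
    using assms by (auto simp: points_Omega lines_def)
  then show "level_map e (Suc 0) \<omega> = level_map e (Suc 0) \<omega>' \<longleftrightarrow> lines \<omega> = lines \<omega>'"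
    and "level_map e 2 \<omega> = level_map e 2 \<omega>' \<longleftrightarrow> \<omega> = \<omega>'"
    using inj by (auto simp: level_map_def inj_on_eq_iff)
qed

lemma level:
  assumes "i \<le> 2"
  shows "points (level e i) = level_map e i ` points Omega"
    and "flow_hom SL2_power Omega (level e i) (level_map e i)"
    and "minimal_flow SL2_power SL2_power_topology (level e i)"
proof -
  have 0: "level e 0 = factor_flow Omega (discrete_topology (UNIV :: unit set)) (\<lambda>_. ()) (level_map e 0)"
    and 1: "level e 1 = factor_flow Omega (product_topology (\<lambda>_. euclidean) UNIV) line_projections (level_map e 1)"
    and 2: "level e 2 = factor_flow Omega (phase Omega) id (level_map e 2)"
    by (simp_all add: level_def)
  have H: "Hausdorff_space (product_topology (\<lambda>_ :: nat. euclidean :: (real^2^2) topology) UNIV)"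
    by (simp add: Hausdorff_space_product_topology Hausdorff_space_euclidean)
  note F = factor_flow[OF minimal_flow_Omega continuous_map_act_Omega]
  have "i = 0 \<or> i = 1 \<or> i = 2" using assms by auto
  then have "points (level e i) = level_map e i ` points Omega \<and>
    flow_hom SL2_power Omega (level e i) (level_map e i) \<and>
    minimal_flow SL2_power SL2_power_topology (level e i)"
  proof (elim disjE)
    assume "i = 0"
    then show ?thesis
      unfolding \<open>i = 0\<close> 0 by (intro conjI F) (auto simp: level_map_def)
  next
    assume "i = 1"
    show ?thesis
      unfolding \<open>i = 1\<close> 1
      by (intro conjI F[OF H continuous_map_line_projections])
         (auto simp: level_map_eq_iff line_projections_eq_iff act_Omega_props(1) intro: lines_act)
  next
    assume "i = 2"
    show ?thesis
      unfolding \<open>i = 2\<close> 2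
      by (intro conjI F[OF Hausdorff_space_Omega]) (auto simp: level_map_eq_iff)
  qed
  then show "points (level e i) = level_map e i ` points Omega"
    "flow_hom SL2_power Omega (level e i) (level_map e i)"
    "minimal_flow SL2_power SL2_power_topology (level e i)" by auto
qed

lemma level_map_mono:
  assumes "i \<le> j" "j \<le> 2" "\<omega> \<in> points Omega" "\<omega>' \<in> points Omega" "level_map e j \<omega> = level_map e j \<omega>'"
  shows "level_map e i \<omega> = level_map e i \<omega>'"
proof (cases "i = 0")
  case True
  then show ?thesis by (simp add: level_map_def)
next
  case False
  then have "i = j \<or> i = 1 \<and> j = 2" using assms(1,2) by auto
  then show ?thesis using assms level_map_eq_iff by auto
qed

definition bond :: "nat \<Rightarrow> nat \<Rightarrow> 'w \<Rightarrow> 'w" where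
  "bond i j = (\<lambda>w. level_map e i (inv_into (points Omega) (level_map e j) w))"

lemma bond:
  assumes "i \<le> j" "j \<le> 2"
  shows "\<omega> \<in> points Omega \<Longrightarrow> bond i j (level_map e j \<omega>) = level_map e i \<omega>"
    and "flow_hom SL2_power (level e j) (level e i) (bond i j)"
proof -
  have ker: "level_map e i x = level_map e i y"
    if "x \<in> points Omega" "y \<in> points Omega" "level_map e j x = level_map e j y" for x y
    using level_map_mono[OF assms that] .
  show "\<omega> \<in> points Omega \<Longrightarrow> bond i j (level_map e j \<omega>) = level_map e i \<omega>"
    unfolding bond_def by (rule induced_hom(1)[where p = "level_map e i", OF ker])
  have i: "i \<le> 2" using assms by simp
  have T2: "Hausdorff_space (phase (level e j))"
    using level(3)[OF assms(2)] by (simp add: minimal_flow_def is_flow_def)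
  show "flow_hom SL2_power (level e j) (level e i) (bond i j)"
    unfolding bond_def
    by (rule induced_hom(2)[OF _ is_flow_Omega T2 level(2)[OF assms(2)] level(1)[OF assms(2)] level(2)[OF i]])
       (rule ker)
qed

text \<open>
  The shears along a single sequence \<open>\<omega>\<close> of rays send every sequence of rays to one that differs
  from \<open>\<omega>\<close> by signs only. On lines they therefore contract the whole space to one point.
\<close>

lemma proximal_step: "proximal_hom SL2_power (level e 1) (level e 0) (bond 0 1)"
  unfolding proximal_hom_def
proof (intro conjI ballI impI bond)
  fix y y' assume "y \<in> points (level e 1)" "y' \<in> points (level e 1)"
  then obtain \<omega> \<omega>' where \<omega>: "\<omega> \<in> points Omega" "y = level_map e 1 \<omega>"
    and \<omega>': "\<omega>' \<in> points Omega" "y' = level_map e 1 \<omega>'"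
    using level(1)[of 1] by auto
  let ?F = "filtermap (shears \<omega>) sequentially"
  have lim: "limitin (phase (level e 1)) (\<lambda>g. act (level e 1) g (level_map e 1 x)) (level_map e 1 \<omega>) ?F"
    if x: "x \<in> points Omega" for x
  proof -
    have "continuous_map (phase Omega) (phase (level e 1)) (level_map e 1)"
      using level(2)[of 1] by (simp add: flow_hom_def)
    from continuous_map_limit[OF this limitin_shears[OF \<omega>(1) x]]
    have "limitin (phase (level e 1)) (\<lambda>k. level_map e 1 (act Omega (shears \<omega> k) x))
        (level_map e 1 (shear_limit \<omega> x)) sequentially"
      by (simp add: o_def)
    moreover have "level_map e 1 (shear_limit \<omega> x) = level_map e 1 \<omega>"
      using x \<omega> by (simp add: shear_limit_def level_map_eq_iff)
    moreover have "level_map e 1 (act Omega g x) = act (level e 1) g (level_map e 1 x)"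
      if "g \<in> carrier SL2_power" for g
      using level(2)[of 1] x that by (simp add: flow_hom_def)
    ultimately show ?thesis
      by (simp add: limitin_def eventually_filtermap shears_carrier)
  qed
  have "eventually (\<lambda>g. g \<in> carrier SL2_power) ?F"
    by (simp add: eventually_filtermap shears_carrier)
  then show "proximal SL2_power (level e 1) y y'"
    unfolding proximal_def using lim[OF \<omega>(1)] lim[OF \<omega>'(1)] \<omega>(2) \<omega>'(2)
    by (intro exI[of _ ?F] exI[of _ y]) (auto simp: filtermap_bot_iff)
qed auto

lemma equicontinuous_step: "equicontinuous_hom SL2_power (level e 2) (level e 1) (bond 1 2)"
proof (rule equicontinuous_hom_compact_fibres)
  show "compact_space signs" by (simp add: compact_space_product_topology compact_space_discrete_topology)
  show "(\<lambda>_. True) \<in> topspace signs" by simp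
  show "continuous_map (prod_topology signs (phase Omega)) (phase Omega) (\<lambda>(\<epsilon>, \<omega>). flip \<epsilon> \<omega>)"
    by (rule continuous_map_flip)
  show "flip (\<lambda>_. True) \<omega> = \<omega>" for \<omega> by (simp add: flip_def)
  show "\<epsilon> = (\<lambda>_. True)" if "\<omega> \<in> points Omega" "flip \<epsilon> \<omega> = \<omega>" for \<epsilon> \<omega>
    using that by (rule flip_eq_self)
  show "flow_hom SL2_power Omega (level e 2) (level_map e 2)" by (rule level) simp
  show "Hausdorff_space (phase (level e 2))"
    using level(3)[of 2] by (simp add: minimal_flow_def is_flow_def)
  show "inj_on (level_map e 2) (points Omega)" by (simp add: inj_on_def level_map_eq_iff)
  show "points (level e 2) = level_map e 2 ` points Omega" by (rule level) simp
  show "flow_hom SL2_power (level e 2) (level e 1) (bond 1 2)" by (rule bond) auto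
  show "\<exists>\<epsilon>\<in>topspace signs. \<omega>' = flip \<epsilon> \<omega>"
    if "\<omega> \<in> points Omega" "\<omega>' \<in> points Omega"
      "bond 1 2 (level_map e 2 \<omega>) = bond 1 2 (level_map e 2 \<omega>')" for \<omega> \<omega>'
    using that by (simp add: bond(1) level_map_eq_iff lines_eq_iff)
qed (auto simp: compact_space_Omega act_flip act_Omega_props(1))

lemma PI_tower_levels:
  assumes "inj_on \<iota> {..2 :: nat}"
  shows "PI_tower SL2_power SL2_power_topology (dir_image (natLeq_on (Suc 2)) \<iota>)
     (\<lambda>a. level e (inv_into {..2} \<iota> a))
     (\<lambda>a b. bond (inv_into {..2} \<iota> a) (inv_into {..2} \<iota> b)) (level e 2)"
  unfolding bond_def
proof (rule PI_tower_of_factors[OF assms minimal_flow_Omega level(3) level(2) level(1) level_map_mono])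
  show "\<exists>p. points (level e 0) = {p}"
    using const_in_Omega[of "ray (axis 1 1)"] level(1)[of 0]
    by (auto simp: level_map_def image_constant_conv axis_eq_0_iff)
  fix i :: nat assume "i < 2"
  then have "i = 0 \<or> i = 1" by auto
  then show "proximal_hom SL2_power (level e (Suc i)) (level e i)
          (\<lambda>w. level_map e i (inv_into (points Omega) (level_map e (Suc i)) w)) \<or>
         equicontinuous_hom SL2_power (level e (Suc i)) (level e i)
          (\<lambda>w. level_map e i (inv_into (points Omega) (level_map e (Suc i)) w))"
    using proximal_step equicontinuous_step by (auto simp: bond_def numeral_2_eq_2)
qed auto

lemma bond_not_inj:
  assumes "i < 2"
  shows "\<not> flow_iso SL2_power (level e (Suc i)) (level e i) (bond i (Suc i))"
proof
  assume "flow_iso SL2_power (level e (Suc i)) (level e i) (bond i (Suc i))"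
  then have inj: "inj_on (bond i (Suc i)) (points (level e (Suc i)))"
    unfolding flow_iso_def by (blast dest: homeomorphic_imp_injective_map)
  have same: "level_map e (Suc i) \<omega> = level_map e (Suc i) \<omega>'"
    if "\<omega> \<in> points Omega" "\<omega>' \<in> points Omega" "level_map e i \<omega> = level_map e i \<omega>'" for \<omega> \<omega>'
    using inj_onD[OF inj, of "level_map e (Suc i) \<omega>" "level_map e (Suc i) \<omega>'"] that assms
      level(1)[of "Suc i"] by (auto simp: bond(1))
  define R S where "R = ray (axis 1 1)" and "S = ray (axis 2 1)"
  have RS: "R \<in> rays" "S \<in> rays" by (auto simp: R_def S_def axis_eq_0_iff)
  have "i = 0 \<or> i = 1" using assms by auto
  then show False
  proof
    assume "i = 0"
    with same[of "\<lambda>_. R" "\<lambda>_. S"] RS have "lines (\<lambda>_. R) = lines (\<lambda>_. S)"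
      by (simp add: const_in_Omega level_map_eq_iff) (simp add: level_map_def)
    then have "R \<union> opp R = S \<union> opp S" by (simp add: lines_def fun_eq_iff)
    then have "S = R \<or> S = opp R" using line_eq_iff RS by blast
    then have "dir S = dir R \<or> dir S = - dir R" using dir_opp RS by auto
    moreover have "dir R = axis 1 1" "dir S = axis 2 1"
      by (simp_all add: R_def S_def dir_ray axis_eq_0_iff sgn_div_norm)
    ultimately show False by (auto simp: vec_eq_iff forall_2 axis_def)
  next
    assume "i = 1"
    let ?x = "\<lambda>_ :: nat. R" and ?\<epsilon> = "\<lambda>_ :: nat. False"
    have x: "?x \<in> points Omega" using RS by (simp add: const_in_Omega)
    have "level_map e 2 ?x = level_map e 2 (flip ?\<epsilon> ?x)"
      using same[of ?x "flip ?\<epsilon> ?x"] x \<open>i = 1\<close> by (simp add: level_map_eq_iff numeral_2_eq_2[symmetric])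
    then have "?x = flip ?\<epsilon> ?x" using x by (simp add: level_map_eq_iff)
    then show False using flip_eq_self[OF x] by (metis)
  qed
qed

end

section \<open>The flow is PI of order two\<close>

text \<open>
  With the identity as encoding, the top level is the product flow itself and not merely an
  isomorphic copy.
\<close>

lemma level_id: "level id 2 = Omega"
proof -
  have inv: "inv_into (points Omega) id x = x" if "x \<in> points Omega" for x
    using inv_into_f_f[of id "points Omega" x] that by simp
  have "(\<lambda>w. id (inv_into (points Omega) id w)) -` U \<inter> id ` points Omega = U"
    if "openin (phase Omega) U" for U
    using openin_subset[OF that] by (auto simp: inv)
  then have "openin (phase (level id 2)) S \<longleftrightarrow> openin (phase Omega) S" for S
    unfolding level_def factor_flow_def level_map_def by (auto simp: openin_pullback_topology)
  then have "phase (level id 2) = phase Omega" by (simp add: topology_eq)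
  moreover have "act (level id 2) = act Omega"
  proof
    fix g
    show "act (level id 2) g = act Omega g"
      using act_Omega_extensional[of g]
      by (auto simp: level_def factor_flow_def level_map_def inv extensional_def fun_eq_iff)
  qed
  ultimately show ?thesis by simp
qed

lemma PI_of_order_Omega: "PI_of_order SL2_power SL2_power_topology 2 Omega"
proof -
  have inj: "inj_on (id :: (nat \<Rightarrow> (real^2) set) \<Rightarrow> _) {\<omega>. \<forall>n. \<omega> n \<noteq> {}}" by simp
  have [simp]: "inv_into {..2 :: nat} id i = i" if "i \<le> 2" for i
    using inv_into_f_f[of id "{..2}" i] that by simp
  have "dir_image (natLeq_on (Suc 2)) id = natLeq_on (Suc 2)" by (auto simp: dir_image_def)
  then have "PI_tower SL2_power SL2_power_topology (natLeq_on (Suc 2))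
     (\<lambda>a. level id (inv_into {..2} id a)) (\<lambda>a b. bond id (inv_into {..2} id a) (inv_into {..2} id b)) Omega"
    using PI_tower_levels[OF inj, of id] level_id by simp
  moreover have "\<not> flow_iso SL2_power (level id (inv_into {..2} id (Suc i))) (level id (inv_into {..2} id i))
      (bond id (inv_into {..2} id i) (inv_into {..2} id (Suc i)))" if "i < 2" for i
    using bond_not_inj[OF inj that] that by simp
  ultimately show ?thesis
    unfolding PI_of_order_def using minimal_flow_Omega by blast
qed

text \<open>
  A PI-flow asks for an extension on points of type \<^typ>\<open>'g set set\<close>. A sequence of nonempty sets of
  vectors can be recovered from its product, here a set of sequences of matrices via the first rows.
\<close>

definition encode :: "(nat \<Rightarrow> (real^2) set) \<Rightarrow> (nat \<Rightarrow> real^2^2) set set" where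
  "encode \<omega> = {{g. \<forall>n. g n $ 1 \<in> \<omega> n}}"

lemma inj_on_encode: "inj_on encode {\<omega>. \<forall>n. \<omega> n \<noteq> {}}"
proof (rule inj_onI, rule ext)
  fix x y n assume x: "x \<in> {\<omega>. \<forall>n. \<omega> n \<noteq> {}}" and y: "y \<in> {\<omega>. \<forall>n. \<omega> n \<noteq> {}}"
    and eq: "encode x = encode y"
  have *: "a n \<subseteq> b n" if a: "\<forall>n. a n \<noteq> {}" and ab: "encode a = encode b"
    for a b :: "nat \<Rightarrow> (real^2) set"
  proof
    fix v assume v: "v \<in> a n"
    define g :: "nat \<Rightarrow> real^2^2" where "g = (\<lambda>m. \<chi> i. if m = n then v else (SOME u. u \<in> a m))"
    have "g m $ 1 \<in> a m" for m using v a by (auto simp: g_def some_in_eq)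
    moreover have "{g :: nat \<Rightarrow> real^2^2. \<forall>n. g n $ 1 \<in> a n} = {g. \<forall>n. g n $ 1 \<in> b n}"
      using ab by (simp add: encode_def)
    ultimately have "g n $ 1 \<in> b n" by blast
    then show "v \<in> b n" by (simp add: g_def)
  qed
  show "x n = y n" using *[of x y] *[of y x] x y eq by auto
qed

lemma proximal_refl:
  assumes "is_flow G TG X" "x \<in> points X"
  shows "proximal G X x x"
proof -
  have "\<one>\<^bsub>G\<^esub> \<in> carrier G"
    using assms by (simp add: is_flow_def topological_group_def group.is_monoid)
  then show ?thesis
    unfolding proximal_def using flow_act(2)[OF assms(1)] assms(2)
    by (intro exI[of _ "principal {\<one>\<^bsub>G\<^esub>}"] exI[of _ x])
       (auto simp: eventually_principal principal_eq_bot_iff intro!: limitin_eventually)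
qed

text \<open>
  The extension is an encoded copy of the flow itself; being an isomorphism, the map back to the flow
  is trivially proximal.
\<close>

lemma PI_flow_Omega: "PI_flow SL2_power SL2_power_topology Omega"
proof -
  let ?Y = "level encode 2"
  note L = level[OF inj_on_encode, of 2, simplified]
  have Y: "is_flow SL2_power SL2_power_topology ?Y" using L(3) by (simp add: minimal_flow_def)
  define \<iota> :: "nat \<Rightarrow> (nat \<Rightarrow> real^2^2) set set" where
    "\<iota> i = (if i = 0 then {} else if i = 1 then {{}} else {UNIV})" for i
  have "inj_on \<iota> {..2}" by (auto simp: inj_on_def \<iota>_def le_Suc_eq numeral_2_eq_2)
  from PI_tower_levels[OF inj_on_encode this]
  have sPI: "strictly_PI SL2_power SL2_power_topology ?Y"
    unfolding strictly_PI_def using L(3) by blast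
  let ?\<theta> = "\<lambda>w. id (inv_into (points Omega) (level_map encode 2) w)"
  have ker: "id x = id y"
    if "x \<in> points Omega" "y \<in> points Omega" "level_map encode 2 x = level_map encode 2 y" for x y
    using level_map_eq_iff(2)[OF inj_on_encode that(1,2)] that(3) by simp
  have "Hausdorff_space (phase ?Y)" using Y by (simp add: is_flow_def)
  then have hom: "flow_hom SL2_power ?Y Omega ?\<theta>"
    by (intro induced_hom(2)[OF _ is_flow_Omega _ L(2) L(1)] ker)
       (auto simp: flow_hom_def)
  have "proximal_hom SL2_power ?Y Omega ?\<theta>"
    unfolding proximal_hom_def
  proof (intro conjI ballI impI hom)
    fix x y assume "x \<in> points ?Y" "y \<in> points ?Y" "?\<theta> x = ?\<theta> y"
    then have "x = y" unfolding L(1) by (metis f_inv_into_f id_apply)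
    then show "proximal SL2_power ?Y x y" using proximal_refl[OF Y] \<open>y \<in> points ?Y\<close> by simp
  qed
  then show ?thesis unfolding PI_flow_def using minimal_flow_Omega sPI by blast
qed

section \<open>Closed conditions satisfied by the enveloping semigroup\<close>

abbreviation maps_Omega :: "((nat \<Rightarrow> (real^2) set) \<Rightarrow> nat \<Rightarrow> (real^2) set) topology" where
  "maps_Omega \<equiv> product_topology (\<lambda>_. phase Omega) (points Omega)"

abbreviation E_Omega :: "((nat \<Rightarrow> (real^2) set) \<Rightarrow> nat \<Rightarrow> (real^2) set) set" where
  "E_Omega \<equiv> enveloping_semigroup SL2_power Omega"

lemma act_in_maps: "g \<in> carrier SL2_power \<Longrightarrow> act Omega g \<in> topspace maps_Omega"
  using act_Omega_props(1)[of g] act_Omega_extensional[of g] by (auto simp: PiE_iff)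

lemma act_in_E: "g \<in> carrier SL2_power \<Longrightarrow> act Omega g \<in> E_Omega"
  unfolding enveloping_semigroup_def
  using act_in_maps closure_of_subset[of "act Omega ` carrier SL2_power" maps_Omega] by blast

text \<open>
  The properties of the enveloping semigroup used below are all obtained in this way: they are
  closed conditions that hold for the group elements.
\<close>

lemma E_minimal:
  "\<lbrakk>closedin maps_Omega C; \<And>g. g \<in> carrier SL2_power \<Longrightarrow> act Omega g \<in> C\<rbrakk> \<Longrightarrow> E_Omega \<subseteq> C"
  unfolding enveloping_semigroup_def by (rule closure_of_minimal) auto

lemma E_maps: "p \<in> E_Omega \<Longrightarrow> p \<in> topspace maps_Omega"
  unfolding enveloping_semigroup_def by (rule subsetD[OF closure_of_subset_topspace])

lemma E_points: "\<lbrakk>p \<in> E_Omega; \<omega> \<in> points Omega\<rbrakk> \<Longrightarrow> p \<omega> \<in> points Omega"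
  using E_maps by (auto simp: PiE_iff)

lemma continuous_map_eval: "\<omega> \<in> points Omega \<Longrightarrow> continuous_map maps_Omega (phase Omega) (\<lambda>p. p \<omega>)"
  by (rule continuous_map_product_projection)

lemma continuous_map_eval_at:
  "\<omega> \<in> points Omega \<Longrightarrow> continuous_map maps_Omega ray_topology (\<lambda>p. p \<omega> n)"
  using continuous_map_compose[OF continuous_map_eval
      continuous_map_product_projection[of n UNIV "\<lambda>_. ray_topology", folded phase_Omega]]
  by (simp add: o_def)

lemma E_flip:
  assumes "p \<in> E_Omega" "\<omega> \<in> points Omega"
  shows "p (flip \<epsilon> \<omega>) = flip \<epsilon> (p \<omega>)"
proof -
  have "continuous_map (phase Omega) (prod_topology signs (phase Omega)) (\<lambda>\<omega>. (\<epsilon>, \<omega>))"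
    by (simp add: continuous_map_pairwise o_def)
  from continuous_map_compose[OF this continuous_map_flip]
  have "continuous_map (phase Omega) (phase Omega) (flip \<epsilon>)" by (simp add: o_def)
  from continuous_map_compose[OF continuous_map_eval[OF assms(2)] this]
  have "continuous_map maps_Omega (phase Omega) (\<lambda>p. flip \<epsilon> (p \<omega>))" by (simp add: o_def)
  then have "closedin maps_Omega {p \<in> topspace maps_Omega. p (flip \<epsilon> \<omega>) = flip \<epsilon> (p \<omega>)}"
    using assms(2) by (intro closedin_continuous_maps_eq[OF Hausdorff_space_Omega] continuous_map_eval) simp_all
  then have "E_Omega \<subseteq> {p \<in> topspace maps_Omega. p (flip \<epsilon> \<omega>) = flip \<epsilon> (p \<omega>)}"
    by (rule E_minimal) (use assms act_in_maps act_flip in auto)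
  then show ?thesis using assms(1) by blast
qed

lemma E_local:
  assumes "p \<in> E_Omega" "\<omega> \<in> points Omega" "\<omega>' \<in> points Omega" "\<omega> n = \<omega>' n"
  shows "p \<omega> n = p \<omega>' n"
proof -
  have "closedin maps_Omega {p \<in> topspace maps_Omega. p \<omega> n = p \<omega>' n}"
    using assms by (intro closedin_continuous_maps_eq[OF Hausdorff_space_rays] continuous_map_eval_at)
  then have "E_Omega \<subseteq> {p \<in> topspace maps_Omega. p \<omega> n = p \<omega>' n}"
    by (rule E_minimal) (use assms act_in_maps act_Omega in auto)
  then show ?thesis using assms(1) by blast
qed

section \<open>Minimal left ideals from shears\<close>

text \<open>
  The group orbit of a limit of shears inside the enveloping semigroup.
\<close>

definition shear_ideal :: "(nat \<Rightarrow> (real^2) set) \<Rightarrow> ((nat \<Rightarrow> (real^2) set) \<Rightarrow> nat \<Rightarrow> (real^2) set) set" where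
  "shear_ideal v = {compose (points Omega) (act Omega g) (shear_limit v) | g. g \<in> carrier SL2_power}"

lemma shear_limit_in_Omega: "\<lbrakk>v \<in> points Omega; \<omega> \<in> points Omega\<rbrakk> \<Longrightarrow> shear_limit v \<omega> \<in> points Omega"
  by (simp add: shear_limit_def)

lemma limitin_in_closure_of:
  assumes "limitin X f l F" "F \<noteq> bot" "\<And>a. f a \<in> S"
  shows "l \<in> X closure_of S"
  unfolding in_closure_of
proof (intro conjI allI impI)
  show "l \<in> topspace X" using assms(1) by (rule limitin_topspace)
  fix T assume "l \<in> T \<and> openin X T"
  then have "eventually (\<lambda>a. f a \<in> T) F" using assms(1) by (simp add: limitin_def)
  then obtain a where "f a \<in> T" using assms(2) eventually_happens' by blast
  then show "\<exists>y. y \<in> S \<and> y \<in> T" using assms(3) by blast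
qed

lemma continuous_map_act_Omega_fixed:
  assumes "g \<in> carrier SL2_power"
  shows "continuous_map (phase Omega) (phase Omega) (act Omega g)"
proof -
  have "continuous_map (phase Omega) (prod_topology SL2_power_topology (phase Omega)) (\<lambda>\<omega>. (g, \<omega>))"
    using assms topological_group_SL2_power
    by (auto simp: continuous_map_pairwise o_def topological_group_def)
  from continuous_map_compose[OF this continuous_map_act_Omega] show ?thesis by (simp add: o_def)
qed

lemma SL2_power_mult: "\<lbrakk>g \<in> carrier SL2_power; h \<in> carrier SL2_power\<rbrakk> \<Longrightarrow> g \<otimes>\<^bsub>SL2_power\<^esub> h \<in> carrier SL2_power"
  using topological_group_SL2_power by (simp add: topological_group_def group.is_monoid monoid.m_closed)

lemma shear_ideal_subset:
  assumes v: "v \<in> points Omega"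
  shows "shear_ideal v \<subseteq> E_Omega"
proof
  fix q assume "q \<in> shear_ideal v"
  then obtain g where g: "g \<in> carrier SL2_power" and q: "q = compose (points Omega) (act Omega g) (shear_limit v)"
    by (auto simp: shear_ideal_def)
  let ?h = "\<lambda>k. g \<otimes>\<^bsub>SL2_power\<^esub> shears v k"
  have h: "?h k \<in> carrier SL2_power" for k using g shears_carrier SL2_power_mult by blast
  have "limitin maps_Omega (\<lambda>k. act Omega (?h k)) q sequentially"
    unfolding limitin_componentwise
  proof (intro conjI ballI)
    show "q \<in> extensional (points Omega)" by (simp add: q compose_def)
    show "\<forall>\<^sub>F k in sequentially. act Omega (?h k) \<in> topspace maps_Omega"
      using act_in_maps[OF h] by simp
    fix \<omega> assume \<omega>: "\<omega> \<in> points Omega"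
    from continuous_map_limit[OF continuous_map_act_Omega_fixed[OF g] limitin_shears[OF v \<omega>]]
    show "limitin (phase Omega) (\<lambda>k. act Omega (?h k) \<omega>) (q \<omega>) sequentially"
      using \<omega> g by (simp add: q compose_def o_def act_Omega_props(3) shears_carrier)
  qed
  then show "q \<in> E_Omega"
    unfolding enveloping_semigroup_def by (rule limitin_in_closure_of) (auto simp: h)
qed

text \<open>
  The value of \<^term>\<open>shear_limit v\<close> at \<open>\<omega>\<close> is \<open>v\<close> up to signs that depend on \<open>\<omega>\<close>. An element \<open>p\<close> of the
  enveloping semigroup commutes with signs, so composing with \<open>p\<close> only depends on the value of \<open>p\<close> at the
  point reached from \<open>v\<close>; by transitivity some group element has the same effect. Hence the orbit is a
  left ideal, and it is minimal because the group acts transitively on it.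
\<close>

lemma minimal_left_ideal_shear:
  assumes v: "v \<in> points Omega"
  shows "minimal_left_ideal SL2_power Omega (shear_ideal v)"
  unfolding minimal_left_ideal_def
proof (intro conjI allI impI)
  interpret group SL2_power using topological_group_SL2_power by (simp add: topological_group_def)
  show "left_ideal SL2_power Omega (shear_ideal v)"
    unfolding left_ideal_def
  proof (intro conjI ballI shear_ideal_subset[OF v])
    show "shear_ideal v \<noteq> {}"
      by (auto simp: shear_ideal_def)
    fix p q assume p: "p \<in> E_Omega" and "q \<in> shear_ideal v"
    then obtain g where g: "g \<in> carrier SL2_power" and q: "q = compose (points Omega) (act Omega g) (shear_limit v)"
      by (auto simp: shear_ideal_def)
    have gv: "act Omega g v \<in> points Omega" using g v by (rule act_Omega_props(1))
    obtain h where h: "h \<in> carrier SL2_power" "act Omega h v = p (act Omega g v)"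
      using Omega_transitive[OF v E_points[OF p gv]] by blast
    have "compose (points Omega) p q = compose (points Omega) (act Omega h) (shear_limit v)"
      using v h p gv by (auto simp: compose_def q shear_limit_def act_flip E_flip)
    then show "compose (points Omega) p q \<in> shear_ideal v" using h by (auto simp: shear_ideal_def)
  qed
  fix J assume J: "left_ideal SL2_power Omega J \<and> J \<subseteq> shear_ideal v"
  then obtain q where "q \<in> J" "q \<in> shear_ideal v" unfolding left_ideal_def by blast
  then obtain g where g: "g \<in> carrier SL2_power" "compose (points Omega) (act Omega g) (shear_limit v) \<in> J"
    unfolding shear_ideal_def by blast
  have "compose (points Omega) (act Omega h) (shear_limit v) \<in> J" if h: "h \<in> carrier SL2_power" for h
  proof -
    \<comment> \<open>One element of the ideal is carried to any other by a single group element.\<close>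
    let ?k = "h \<otimes>\<^bsub>SL2_power\<^esub> inv\<^bsub>SL2_power\<^esub> g"
    have k: "?k \<in> carrier SL2_power" using g h by simp
    have kg: "act Omega ?k (act Omega g \<omega>) = act Omega h \<omega>" if "\<omega> \<in> points Omega" for \<omega>
    proof -
      have "?k \<otimes>\<^bsub>SL2_power\<^esub> g = h"
        using g h by (simp add: m_assoc)
      then show ?thesis using act_Omega_props(3)[OF k g(1) that] by simp
    qed
    have "compose (points Omega) (act Omega ?k) (compose (points Omega) (act Omega g) (shear_limit v)) \<in> J"
      using J g act_in_E[OF k] by (auto simp: left_ideal_def)
    moreover have "compose (points Omega) (act Omega ?k) (compose (points Omega) (act Omega g) (shear_limit v)) =
        compose (points Omega) (act Omega h) (shear_limit v)"
      using kg shear_limit_in_Omega[OF v] by (auto simp: compose_def)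
    ultimately show ?thesis by simp
  qed
  then show "J = shear_ideal v" using J by (auto simp: shear_ideal_def)
qed

lemma side_ray:
  assumes "u \<noteq> 0" "w \<noteq> 0"
  shows "cross2 u w > 0 \<Longrightarrow> side (ray u) (ray w)"
    and "cross2 u w < 0 \<Longrightarrow> \<not> side (ray u) (ray w)"
proof -
  have c: "cross2 u w = norm u * norm w * cross2 (dir (ray u)) (dir (ray w))"
    using assms by (simp add: dir_ray cross2_def sgn_div_norm field_simps)
  have n: "norm u * norm w > 0" using assms by simp
  show "cross2 u w > 0 \<Longrightarrow> side (ray u) (ray w)"
    unfolding c side_def using n zero_less_mult_pos by blast
  assume neg: "cross2 u w < 0"
  then have "cross2 (dir (ray u)) (dir (ray w)) < 0"
    unfolding c using n by (metis mult_less_cancel_left_pos mult_zero_right)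
  then show "\<not> side (ray u) (ray w)"
    by (auto simp: side_def cross2_def)
qed

definition slope_ray :: "real \<Rightarrow> (real^2) set" where
  "slope_ray t = ray (vector [1, t])"

lemma vector_1_neq_0: "(vector [1, t] :: real^2) \<noteq> 0"
  by (metis vector_2(1) zero_index zero_neq_one)

lemma slope_ray_in: "slope_ray t \<in> rays"
  by (simp add: slope_ray_def vector_1_neq_0)

text \<open>
  All elements of one of these ideals identify the same pairs of points, namely those with equal
  signs. For slopes \<open>s < m < t\<close> the rays of slope \<open>m\<close> and \<open>t\<close> lie on the same side of the ray of slope
  \<open>s\<close>, but they are separated by the half circle that starts at the ray of slope \<open>t\<close>.
\<close>

lemma shear_ideal_slopes_distinct:
  assumes "s < t"
  shows "shear_ideal (\<lambda>_. slope_ray s) \<noteq> shear_ideal (\<lambda>_. slope_ray t)"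
proof
  \<comment> \<open>Any slope strictly between the two would do.\<close>
  define m where "m = (s + t) / 2"
  let ?F = "\<lambda>r. shear_limit (\<lambda>_. slope_ray r)"
  let ?c = "\<lambda>r n. slope_ray r"
  assume eq: "shear_ideal (\<lambda>_. slope_ray s) = shear_ideal (\<lambda>_. slope_ray t)"
  have in_\<Omega>: "?c r \<in> points Omega" for r by (simp add: const_in_Omega slope_ray_in)
  have one: "\<one>\<^bsub>SL2_power\<^esub> \<in> carrier SL2_power"
    using topological_group_SL2_power by (simp add: topological_group_def group.is_monoid)
  have "compose (points Omega) (act Omega \<one>\<^bsub>SL2_power\<^esub>) (?F t) \<in> shear_ideal (?c t)"
    using one by (auto simp: shear_ideal_def)
  then obtain g where g: "compose (points Omega) (act Omega \<one>\<^bsub>SL2_power\<^esub>) (?F t) =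
      compose (points Omega) (act Omega g) (?F s)"
    unfolding eq[symmetric] by (auto simp: shear_ideal_def)
  have Fg: "?F t (?c r) = act Omega g (?F s (?c r))" for r
  proof -
    have "act Omega \<one>\<^bsub>SL2_power\<^esub> (?F t (?c r)) = act Omega g (?F s (?c r))"
      using fun_cong[OF g, of "?c r"] in_\<Omega> by (simp add: compose_def)
    then show ?thesis using act_Omega_props(2) shear_limit_in_Omega in_\<Omega> by simp
  qed
  have sm: "s < m" and mt: "m < t" using assms by (auto simp: m_def)
  have cr: "cross2 (vector [1, a]) (vector [1, b]) = b - a" for a b by (simp add: cross2_def)
  have pos: "side (slope_ray a) (slope_ray b)" if "a < b" for a b
    unfolding slope_ray_def using that by (intro side_ray(1)) (auto simp: cr vector_1_neq_0)
  have neg: "\<not> side (slope_ray a) (slope_ray b)" if "b < a" for a b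
    unfolding slope_ray_def using that by (intro side_ray(2)) (auto simp: cr vector_1_neq_0)
  have "?F s (?c m) = ?F s (?c t)"
    using pos[OF sm] pos[OF assms] in_\<Omega> by (simp add: shear_limit_def)
  then have "?F t (?c m) = ?F t (?c t)" using Fg by simp
  moreover have "?F t (?c t) = ?c t" using in_\<Omega> by (simp add: shear_limit_def flip_def side_def)
  moreover have "?F t (?c m) = (\<lambda>_. opp (slope_ray t))"
    using neg[OF mt] in_\<Omega> by (simp add: shear_limit_def flip_def)
  ultimately show False using opp_neq[OF slope_ray_in] by (metis)
qed

lemma minimal_left_ideals_disjoint:
  assumes "minimal_left_ideal G X I" "minimal_left_ideal G X J" "q \<in> I" "q \<in> J"
  shows "I = J"
proof -
  have "left_ideal G X (I \<inter> J)"
    using assms by (auto simp: minimal_left_ideal_def left_ideal_def)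
  then have "I \<inter> J = I" "I \<inter> J = J"
    using assms unfolding minimal_left_ideal_def by blast+
  then show ?thesis by simp
qed

section \<open>Counting the minimal left ideals\<close>

text \<open>
  A point is determined by the members of a countable basis that contain it.
\<close>

lemma second_countable_lepoll_reals:
  "(UNIV :: 'a :: {second_countable_topology, t2_space} set) \<lesssim> (UNIV :: real set)"
proof -
  obtain B :: "'a set set" where B: "countable B" "topological_basis B"
    using ex_countable_basis by blast
  let ?f = "\<lambda>x. to_nat_on B ` {b \<in> B. x \<in> b}"
  have "inj ?f"
  proof (rule injI, rule ccontr)
    fix x y assume eq: "?f x = ?f y" and "x \<noteq> y"
    then obtain U V where "open U" "x \<in> U" "y \<notin> U" by (metis hausdorff disjoint_iff)
    then obtain b where b: "b \<in> B" "x \<in> b" "b \<subseteq> U"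
      using topological_basisE[OF B(2)] by metis
    have "{b \<in> B. x \<in> b} = {b \<in> B. y \<in> b}"
      using eq inj_on_image_eq_iff[OF inj_on_to_nat_on[OF B(1)]] by auto
    then show False using b \<open>y \<notin> U\<close> by blast
  qed
  then have "(UNIV :: 'a set) \<lesssim> (UNIV :: nat set set)"
    unfolding lepoll_def by blast
  then show ?thesis
    using lepoll_trans eqpoll_imp_lepoll[OF nat_sets_eqpoll_reals] by blast
qed

text \<open>
  The limit of a net of matrices \<open>A\<close> is controlled by a limit point \<open>B\<close> of the normalized matrices
  \<open>A / norm A\<close>. Instead of passing to subnets, the pairs of \<open>B\<close> and \<open>p\<close> with the stated property are seen to
  form a closed set, whose projection along the compact unit sphere of matrices is closed and contains
  the group. Since a ray contains the origin, the condition says nothing about vectors in the kernel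
  of \<open>B\<close>.
\<close>

lemma E_matrix:
  assumes "p \<in> E_Omega"
  shows "\<exists>B. norm B = 1 \<and> (\<forall>\<omega>\<in>points Omega. \<forall>v\<in>\<omega> n. B *v v \<in> p \<omega> n)"
proof -
  let ?S = "top_of_set (sphere (0 :: real^2^2) 1)"
  let ?P = "prod_topology ?S maps_Omega"
  define I where "I = {(\<omega>, v). \<omega> \<in> points Omega \<and> v \<in> \<omega> n}"
  define C where "C = {x \<in> topspace ?P. \<forall>i\<in>I. fst x *v snd i = norm (fst x *v snd i) *\<^sub>R dir (snd x (fst i) n)}"
  have "closedin ?P {x \<in> topspace ?P. fst x *v v = norm (fst x *v v) *\<^sub>R dir (snd x \<omega> n)}"
    if \<omega>: "\<omega> \<in> points Omega" for \<omega> and v :: "real^2"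
  proof (rule closedin_continuous_maps_eq[OF Hausdorff_space_euclidean])
    have "continuous_map ?P euclidean fst"
      by (meson continuous_map_fst continuous_map_into_fulltopology)
    moreover have "continuous_map euclidean euclidean (\<lambda>B :: real^2^2. B *v v)"
      unfolding matrix_vector_mult_def continuous_map_iff_continuous2 by (intro continuous_intros)
    ultimately have "continuous_map ?P euclidean ((\<lambda>B. B *v v) \<circ> fst)" by (rule continuous_map_compose)
    then show c: "continuous_map ?P euclidean (\<lambda>x. fst x *v v)" by (simp add: o_def)
    have "continuous_map ?P euclidean (dir \<circ> ((\<lambda>p. p \<omega> n) \<circ> snd))"
      by (intro continuous_map_compose[OF _ continuous_map_dir]
          continuous_map_compose[OF continuous_map_snd continuous_map_eval_at[OF \<omega>]])
    then have "continuous_map ?P euclidean (\<lambda>x. (fst x *v v, dir (snd x \<omega> n)))"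
      using c by (simp add: continuous_map_pairwise o_def flip: prod_topology_euclidean)
    moreover have "continuous_map euclidean euclidean (\<lambda>(a :: real^2, b :: real^2). norm a *\<^sub>R b)"
      unfolding continuous_map_iff_continuous2 case_prod_beta by (intro continuous_intros)
    ultimately have "continuous_map ?P euclidean
        ((\<lambda>(a, b). norm a *\<^sub>R b) \<circ> (\<lambda>x. (fst x *v v, dir (snd x \<omega> n))))"
      by (rule continuous_map_compose)
    then show "continuous_map ?P euclidean (\<lambda>x. norm (fst x *v v) *\<^sub>R dir (snd x \<omega> n))"
      by (simp add: o_def)
  qed
  then have cl: "closedin ?P {x \<in> topspace ?P. fst x *v snd i = norm (fst x *v snd i) *\<^sub>R dir (snd x (fst i) n)}"
    if "i \<in> I" for i
    using that by (auto simp: I_def)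
  have ne: "I \<noteq> {}"
  proof -
    let ?R = "ray (axis 1 1)"
    have "axis 1 1 \<in> ?R" by (auto simp: ray_def intro: exI[of _ 1])
    then have "(\<lambda>_. ?R, axis 1 1) \<in> I" by (simp add: I_def const_in_Omega axis_eq_0_iff)
    then show ?thesis by blast
  qed
  have "C = (\<Inter>i\<in>I. {x \<in> topspace ?P. fst x *v snd i = norm (fst x *v snd i) *\<^sub>R dir (snd x (fst i) n)})"
    using ne by (auto simp: C_def)
  then have "closedin ?P C" by (simp only:) (rule closedin_INT[OF ne cl])
  moreover have "closed_map ?P maps_Omega snd"
    by (rule closed_map_snd) (simp add: compact_space_subtopology)
  ultimately have "closedin maps_Omega (snd ` C)" by (auto simp: closed_map_def)
  then have "E_Omega \<subseteq> snd ` C"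
  proof (rule E_minimal)
    fix g assume g: "g \<in> carrier SL2_power"
    let ?A = "g n" let ?B = "inverse (norm ?A) *\<^sub>R ?A"
    have A: "?A \<in> carrier SL2" using g by (simp add: carrier_SL2_power)
    then have "?A \<noteq> 0" by (auto simp: SL2_def det_2)
    then have "norm ?B = 1" by simp
    moreover have "?B *v v = norm (?B *v v) *\<^sub>R dir (act Omega g \<omega> n)" if "(\<omega>, v) \<in> I" for \<omega> v
    proof -
      have \<omega>: "\<omega> \<in> points Omega" and v: "v \<in> \<omega> n" using that by (auto simp: I_def)
      then have R: "\<omega> n \<in> rays" by (simp add: points_Omega)
      then have "?A *v v \<in> act ray_flow ?A (\<omega> n)" using v by (simp add: ray_flow_def)
      then have "?A *v v = norm (?A *v v) *\<^sub>R dir (act ray_flow ?A (\<omega> n))"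
        using in_ray_iff act_rays[OF A R] by blast
      then have "inverse (norm ?A) *\<^sub>R (?A *v v) =
          inverse (norm ?A) *\<^sub>R (norm (?A *v v) *\<^sub>R dir (act ray_flow ?A (\<omega> n)))"
        by (rule arg_cong)
      then show ?thesis using \<omega>
        by (simp add: act_Omega scaleR_matrix_vector_assoc[symmetric] dir(1)[OF act_rays[OF A R]])
    qed
    ultimately have "(?B, act Omega g) \<in> C" using act_in_maps[OF g] by (auto simp: C_def)
    then show "act Omega g \<in> snd ` C" by force
  qed
  then obtain B where B: "(B, p) \<in> C" using assms by force
  then have "norm B = 1" by (auto simp: C_def)
  moreover have "B *v v \<in> p \<omega> n" if "\<omega> \<in> points Omega" "v \<in> \<omega> n" for \<omega> v
    using B that in_ray_iff[of "p \<omega> n" "B *v v"] E_points[OF assms that(1)]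
    by (auto simp: C_def I_def points_Omega)
  ultimately show ?thesis by blast
qed

lemma kernel_parallel:
  fixes B :: "real^2^2"
  assumes "B *v u = 0" "B *v w = 0" "B \<noteq> 0"
  shows "cross2 u w = 0"
proof -
  have rows: "B $ i $ 1 * u $ 1 + B $ i $ 2 * u $ 2 = 0" "B $ i $ 1 * w $ 1 + B $ i $ 2 * w $ 2 = 0" for i
    using arg_cong[OF assms(1), of "\<lambda>x. x $ i"] arg_cong[OF assms(2), of "\<lambda>x. x $ i"]
    by (simp_all add: matrix_vector_mult_def sum_2)
  have "B $ i $ 1 * cross2 u w =
      w $ 2 * (B $ i $ 1 * u $ 1 + B $ i $ 2 * u $ 2) - u $ 2 * (B $ i $ 1 * w $ 1 + B $ i $ 2 * w $ 2)"
    "B $ i $ 2 * cross2 u w =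
      u $ 1 * (B $ i $ 1 * w $ 1 + B $ i $ 2 * w $ 2) - w $ 1 * (B $ i $ 1 * u $ 1 + B $ i $ 2 * u $ 2)" for i
    by (simp_all add: cross2_def algebra_simps)
  then have "B $ i $ j * cross2 u w = 0" for i j
    unfolding rows using exhaust_2[of j] by auto
  then show ?thesis using assms(3) by (auto simp: vec_eq_iff)
qed

text \<open>
  In each coordinate \<open>p\<close> is determined by its matrix away from the kernel. The matrix is nonzero, so the
  kernel contains at most one pair of opposite rays, and because \<open>p\<close> commutes with signs its value on
  one of the two determines the other. Hence countably many matrices and unit vectors encode \<open>p\<close>.
\<close>

lemma E_lepoll_reals: "E_Omega \<lesssim> (UNIV :: real set)"
proof -
  define B :: "((nat \<Rightarrow> (real^2) set) \<Rightarrow> nat \<Rightarrow> (real^2) set) \<Rightarrow> nat \<Rightarrow> real^2^2" where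
    "B p n = (SOME A. norm A = 1 \<and> (\<forall>\<omega>\<in>points Omega. \<forall>v\<in>\<omega> n. A *v v \<in> p \<omega> n))" for p n
  have "norm (B p n) = 1 \<and> (\<forall>\<omega>\<in>points Omega. \<forall>v\<in>\<omega> n. B p n *v v \<in> p \<omega> n)"
    if "p \<in> E_Omega" for p n
    unfolding B_def by (rule someI_ex[OF E_matrix[OF that]])
  then have B: "norm (B p n) = 1" "\<And>\<omega> v. \<lbrakk>\<omega> \<in> points Omega; v \<in> \<omega> n\<rbrakk> \<Longrightarrow> B p n *v v \<in> p \<omega> n"
    if "p \<in> E_Omega" for p n
    using that by blast+
  \<comment> \<open>A ray in the kernel, with an arbitrary default if the kernel is trivial.\<close>
  define K where "K A = ray (SOME k. k \<noteq> 0 \<and> A *v k = 0)" for A :: "real^2^2"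
  define c where "c p n = (B p n, dir (p (\<lambda>_. K (B p n)) n))" for p and n :: nat
  have "inj_on c E_Omega"
  proof (rule inj_onI)
    fix p q assume p: "p \<in> E_Omega" and q: "q \<in> E_Omega" and eq: "c p = c q"
    have "p \<omega> n = q \<omega> n" if \<omega>: "\<omega> \<in> points Omega" for \<omega> n
    proof -
      let ?A = "B p n"
      have A: "B q n = ?A" and d: "dir (p (\<lambda>_. K ?A) n) = dir (q (\<lambda>_. K ?A) n)"
        using fun_cong[OF eq, of n] by (auto simp: c_def)
      let ?u = "dir (\<omega> n)"
      have R: "\<omega> n \<in> rays" using \<omega> by (simp add: points_Omega)
      then have u: "?u \<in> \<omega> n" "?u \<noteq> 0" using dir[OF R] by (auto simp: in_ray_iff)
      have rp: "r \<omega> n \<in> rays" if "r \<in> E_Omega" "\<omega> \<in> points Omega" for r \<omega>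
        using E_points[OF that] by (simp add: points_Omega)
      show ?thesis
      proof (cases "?A *v ?u = 0")
        case False
        then show ?thesis
          using ray_eq_if_mem rp[OF p \<omega>] rp[OF q \<omega>] B(2)[OF p \<omega> u(1)] B(2)[OF q \<omega> u(1)] A by metis
      next
        case True
        define k where "k = (SOME k. k \<noteq> 0 \<and> ?A *v k = 0)"
        have k: "k \<noteq> 0 \<and> ?A *v k = 0"
          unfolding k_def by (rule someI[of _ ?u]) (use True u in auto)
        have KA: "K ?A = ray k" by (simp add: K_def k_def)
        then have KR: "K ?A \<in> rays" and dk: "dir (K ?A) = sgn k" using k by (auto simp: dir_ray)
        have "?A *v dir (K ?A) = 0"
          using k by (simp add: dk sgn_div_norm matrix_vector_mult_scaleR)
        moreover have "?A \<noteq> 0" using B(1)[OF p, of n] by auto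
        ultimately have "cross2 (dir (K ?A)) ?u = 0" using True kernel_parallel by blast
        then have par: "\<omega> n = K ?A \<or> \<omega> n = opp (K ?A)" using rays_parallel[OF KR R] by blast
        let ?k = "\<lambda>_ :: nat. K ?A"
        have k\<Omega>: "?k \<in> points Omega" using KR by (rule const_in_Omega)
        have same: "p ?k n = q ?k n" using d dir_inj rp[OF p k\<Omega>] rp[OF q k\<Omega>] by blast
        from par show ?thesis
        proof
          assume "\<omega> n = K ?A"
          then show ?thesis using same E_local[OF p \<omega> k\<Omega>] E_local[OF q \<omega> k\<Omega>] by metis
        next
          assume "\<omega> n = opp (K ?A)"
          then have "\<omega> n = flip (\<lambda>_. False) ?k n" by (simp add: flip_def)
          then have o: "r \<omega> n = opp (r ?k n)" if "r \<in> E_Omega" for r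
            using E_local[OF that \<omega> flip_in_Omega[OF k\<Omega>]] E_flip[OF that k\<Omega>] by (metis flip_def)
          show ?thesis using o[OF p] o[OF q] same by simp
        qed
      qed
    qed
    then show "p = q"
      using E_maps[OF p] E_maps[OF q] by (intro extensionalityI[of _ "points Omega"]) (auto simp: PiE_iff)
  qed
  then have "E_Omega \<lesssim> (UNIV :: (nat \<Rightarrow> (real^2^2) \<times> (real^2)) set)"
    unfolding lepoll_def by blast
  then show ?thesis using second_countable_lepoll_reals lepoll_trans by blast
qed

text \<open>
  Minimal left ideals are pairwise disjoint, so choosing an element of each bounds their number by
  that of the enveloping semigroup.
\<close>

lemma minimal_left_ideals_eqpoll:
  "{I. minimal_left_ideal SL2_power Omega I} \<approx> (UNIV :: real set)"
proof (rule lepoll_antisym)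
  define f where "f I = (SOME q. q \<in> I)" for I :: "((nat \<Rightarrow> (real^2) set) \<Rightarrow> nat \<Rightarrow> (real^2) set) set"
  have f: "f I \<in> I" "f I \<in> E_Omega" if "minimal_left_ideal SL2_power Omega I" for I
    using that some_in_eq[of I] by (auto simp: f_def minimal_left_ideal_def left_ideal_def)
  then have "inj_on f {I. minimal_left_ideal SL2_power Omega I}"
    by (intro inj_onI) (metis mem_Collect_eq minimal_left_ideals_disjoint)
  then have "{I. minimal_left_ideal SL2_power Omega I} \<lesssim> E_Omega"
    unfolding lepoll_def using f by blast
  then show "{I. minimal_left_ideal SL2_power Omega I} \<lesssim> (UNIV :: real set)"
    using E_lepoll_reals lepoll_trans by blast
  have "inj (\<lambda>t. shear_ideal (\<lambda>_. slope_ray t))"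
    by (rule injI) (metis linorder_neqE shear_ideal_slopes_distinct)
  moreover have "minimal_left_ideal SL2_power Omega (shear_ideal (\<lambda>_. slope_ray t))" for t
    by (intro minimal_left_ideal_shear const_in_Omega slope_ray_in)
  ultimately show "(UNIV :: real set) \<lesssim> {I. minimal_left_ideal SL2_power Omega I}"
    unfolding lepoll_def by blast
qed

theorem mainTheorem2:
  shows "metrizable_space (phase Omega) \<and>
    minimal_flow SL2_power SL2_power_topology Omega \<and>
    PI_flow SL2_power SL2_power_topology Omega \<and>
    PI_of_order SL2_power SL2_power_topology 2 Omega \<and>
    {I. minimal_left_ideal SL2_power Omega I} \<approx> (UNIV :: real set)"
  using metrizable_space_Omega minimal_flow_Omega PI_flow_Omega PI_of_order_Omega
    minimal_left_ideals_eqpoll by blast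

end
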